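(* Let $k$ be a non-zero integer and let $\alpha:\mathbb{R}\to\mathbb{R}$ be a smooth function. The rotationally symmetric map $\varphi:\mathbb{R}\times S^1\to S^2$, $$\varphi(s,t)=(\cos\alpha(s),\ \sin\alpha(s)e^{ikt}),$$ is an infinity-harmonic map if and only if (1) $\alpha$ is constant and $\varphi$ is the projection onto the second factor followed by a homothetic immersion, or (2) $\alpha(s)=2\arctan(e^{ks+A})-\pi/2$, where $A$ is any constant, or (3) $2\alpha$ is a solution of the pendulum equation $$\frac{d^2\theta}{dt^2}+k^2\sin\theta=0.$$ In case (3), with $T$ denoting the period of $\alpha$ ($\alpha$ being periodic), the map $\varphi$ factors to an infinity-harmonic map from the torus $\mathbb{R}/\langle T\rangle\times S^1$ to $S^2$.
   Context: $S^2$ is the unit sphere in $\mathbb{R}^3=\mathbb{R}\oplus\mathbb{C}$, with its induced metric. The cylinder $\mathbb{R}\times S^1$ is parametrized as $\{(s,e^{it}):(s,t)\in\mathbb{R}\times\mathbb{R}\}$ with its standard flat product metric $ds^2+dt^2$. A $C^2$ map $\psi:(M,g)\to(N,h)$ between Riemannian manifolds is infinity-harmonic if $\frac12\, d\psi(\mathrm{grad}\,|d\psi|^2)=0$, where $|d\psi|_x^2=\sum_i h(d\psi(e_i),d\psi(e_i))$ for an orthonormal basis $\{e_i\}$ of $T_xM$.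
   Formalization: In case (3) α need not be periodic (the functions in (2) also satisfy (3) and are monotone), so periodicity of α is assumed rather than claimed: the factoring through the torus is stated for every T > 0 with α(s+T) = α(s) for all s. *)

theory Defs
  imports "HOL-Analysis.Analysis"
begin

section \<open>Functions of class \<open>C\<^sup>n\<close>\<close>

text \<open>Intended for open \<open>S\<close>; all iterated directional derivatives are required to exist and
  to be continuous.\<close>

primrec Ck_on :: "nat \<Rightarrow> ('e::euclidean_space \<Rightarrow> 'b::real_normed_vector) \<Rightarrow> 'e set \<Rightarrow> bool" where
  "Ck_on 0 f S \<longleftrightarrow> continuous_on S f"
| "Ck_on (Suc n) f S \<longleftrightarrow> (\<forall>x\<in>S. f differentiable (at x)) \<and>
     (\<forall>v. Ck_on n (\<lambda>x. frechet_derivative f (at x) v) S)"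

definition smooth_on :: "('e::euclidean_space \<Rightarrow> 'b::real_normed_vector) \<Rightarrow> 'e set \<Rightarrow> bool" where
  "smooth_on f S \<longleftrightarrow> (\<forall>n. Ck_on n f S)"

section \<open>Riemannian manifolds\<close>

text \<open>A manifold modelled on the Euclidean space \<open>'e\<close> is given by its set of points and a family
  of local parametrizations \<open>(U, p)\<close>, where \<open>U\<close> is open in \<open>'e\<close> and \<open>p\<close> maps \<open>U\<close> injectively
  to points, so \<open>p\<close> is the inverse of a chart. The Riemannian metric \<open>g\<close> is recorded through its
  pullbacks: \<open>pullback_metric M p u v w = g (dp\<^sub>u v) (dp\<^sub>u w)\<close>.\<close>

record ('e, 'a) riem =
  points :: "'a set"
  params :: "('e set \<times> ('e \<Rightarrow> 'a)) set"
  pullback_metric :: "('e \<Rightarrow> 'a) \<Rightarrow> 'e \<Rightarrow> 'e \<Rightarrow> 'e \<Rightarrow> real"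

text \<open>The expression \<open>q\<inverse> \<circ> \<psi> \<circ> p\<close> of \<open>\<psi>\<close> in local coordinates, and its domain.\<close>

definition loc_dom :: "'e set \<times> ('e \<Rightarrow> 'a) \<Rightarrow> 'f set \<times> ('f \<Rightarrow> 'b) \<Rightarrow> ('a \<Rightarrow> 'b) \<Rightarrow> 'e set" where
  "loc_dom c d \<psi> = {u \<in> fst c. \<psi> (snd c u) \<in> snd d ` fst d}"

definition loc :: "'e set \<times> ('e \<Rightarrow> 'a) \<Rightarrow> 'f set \<times> ('f \<Rightarrow> 'b) \<Rightarrow> ('a \<Rightarrow> 'b) \<Rightarrow> 'e \<Rightarrow> 'f" where
  "loc c d \<psi> = (\<lambda>u. the_inv_into (fst d) (snd d) (\<psi> (snd c u)))"

definition dloc :: "'e::euclidean_space set \<times> ('e \<Rightarrow> 'a) \<Rightarrow> 'f::euclidean_space set \<times> ('f \<Rightarrow> 'b) \<Rightarrow>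
    ('a \<Rightarrow> 'b) \<Rightarrow> 'e \<Rightarrow> 'e \<Rightarrow> 'f" where
  "dloc c d \<psi> u = frechet_derivative (loc c d \<psi>) (at u)"

definition Ck_map :: "nat \<Rightarrow> ('e::euclidean_space, 'a) riem \<Rightarrow> ('f::euclidean_space, 'b) riem \<Rightarrow>
    ('a \<Rightarrow> 'b) \<Rightarrow> bool" where
  "Ck_map n M N \<psi> \<longleftrightarrow> \<psi> ` points M \<subseteq> points N \<and>
     (\<forall>c\<in>params M. \<forall>d\<in>params N. open (loc_dom c d \<psi>) \<and> Ck_on n (loc c d \<psi>) (loc_dom c d \<psi>))"

definition smooth_map :: "('e::euclidean_space, 'a) riem \<Rightarrow> ('f::euclidean_space, 'b) riem \<Rightarrow>
    ('a \<Rightarrow> 'b) \<Rightarrow> bool" where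
  "smooth_map M N \<psi> \<longleftrightarrow> (\<forall>n. Ck_map n M N \<psi>)"

text \<open>The pullback \<open>(\<psi>\<^sup>* h)\<close> of the metric \<open>h\<close> of \<open>N\<close> in local coordinates.\<close>

definition pullback_form :: "('f::euclidean_space, 'b) riem \<Rightarrow>
    'e::euclidean_space set \<times> ('e \<Rightarrow> 'a) \<Rightarrow> 'f set \<times> ('f \<Rightarrow> 'b) \<Rightarrow>
    ('a \<Rightarrow> 'b) \<Rightarrow> 'e \<Rightarrow> 'e \<Rightarrow> 'e \<Rightarrow> real" where
  "pullback_form N c d \<psi> u v w =
     pullback_metric N (snd d) (loc c d \<psi> u) (dloc c d \<psi> u v) (dloc c d \<psi> u w)"

text \<open>Smooth compatibility of the parametrizations is smoothness of the identity map, and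
  compatibility of the local metrics says that the identity map is isometric. The topology is the
  one generated by the images \<open>p ` U\<close> of open sets; it has to be Hausdorff and second countable.\<close>

definition riemannian_manifold :: "('e::euclidean_space, 'a) riem \<Rightarrow> bool" where
  "riemannian_manifold M \<longleftrightarrow>
     (\<forall>(U, p)\<in>params M. open U \<and> inj_on p U \<and> p ` U \<subseteq> points M) \<and>
     (\<exists>C\<subseteq>params M. countable C \<and> points M = (\<Union>(U, p)\<in>C. p ` U)) \<and>
     (\<forall>x\<in>points M. \<forall>y\<in>points M. x \<noteq> y \<longrightarrow>
        (\<exists>(U, p)\<in>params M. \<exists>(V, q)\<in>params M. \<exists>U'\<subseteq>U. \<exists>V'\<subseteq>V. open U' \<and> open V' \<and>
           x \<in> p ` U' \<and> y \<in> q ` V' \<and> p ` U' \<inter> q ` V' = {})) \<and>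
     smooth_map M M id \<and>
     (\<forall>(U, p)\<in>params M. \<forall>u\<in>U. bilinear (pullback_metric M p u) \<and>
        (\<forall>v w. pullback_metric M p u v w = pullback_metric M p u w v) \<and>
        (\<forall>v. v \<noteq> 0 \<longrightarrow> pullback_metric M p u v v > 0)) \<and>
     (\<forall>(U, p)\<in>params M. \<forall>v w. smooth_on (\<lambda>u. pullback_metric M p u v w) U) \<and>
     (\<forall>c\<in>params M. \<forall>d\<in>params M. \<forall>u\<in>loc_dom c d id.
        pullback_form M c d id u = pullback_metric M (snd c) u)"

section \<open>Infinity-harmonic maps and homothetic immersions\<close>

definition orthonormal_basis :: "('e::euclidean_space \<Rightarrow> 'e \<Rightarrow> real) \<Rightarrow> 'e set \<Rightarrow> bool" where
  "orthonormal_basis g B \<longleftrightarrow> finite B \<and> card B = DIM('e) \<and>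
     (\<forall>a\<in>B. \<forall>b\<in>B. g a b = (if a = b then 1 else 0))"

text \<open>\<open>|d\<psi>|\<^sup>2\<close> in local coordinates; the value does not depend on the chosen orthonormal basis.\<close>

definition energy_density :: "('e::euclidean_space, 'a) riem \<Rightarrow> ('f::euclidean_space, 'b) riem \<Rightarrow>
    'e set \<times> ('e \<Rightarrow> 'a) \<Rightarrow> 'f set \<times> ('f \<Rightarrow> 'b) \<Rightarrow> ('a \<Rightarrow> 'b) \<Rightarrow> 'e \<Rightarrow> real" where
  "energy_density M N c d \<psi> u =
     (\<Sum>e\<in>(SOME B. orthonormal_basis (pullback_metric M (snd c) u) B). pullback_form N c d \<psi> u e e)"

definition grad :: "('e::euclidean_space, 'a) riem \<Rightarrow> 'e set \<times> ('e \<Rightarrow> 'a) \<Rightarrow> ('e \<Rightarrow> real) \<Rightarrow> 'e \<Rightarrow> 'e" where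
  "grad M c F u =
     (THE v. \<forall>w. pullback_metric M (snd c) u v w = frechet_derivative F (at u) w)"

definition infinity_harmonic :: "('e::euclidean_space, 'a) riem \<Rightarrow> ('f::euclidean_space, 'b) riem \<Rightarrow>
    ('a \<Rightarrow> 'b) \<Rightarrow> bool" where
  "infinity_harmonic M N \<psi> \<longleftrightarrow> Ck_map 2 M N \<psi> \<and>
     (\<forall>c\<in>params M. \<forall>d\<in>params N. \<forall>u\<in>loc_dom c d \<psi>.
        (1/2) *\<^sub>R dloc c d \<psi> u (grad M c (energy_density M N c d \<psi>) u) = 0)"

definition homothetic_immersion :: "('e::euclidean_space, 'a) riem \<Rightarrow>
    ('f::euclidean_space, 'b) riem \<Rightarrow> ('a \<Rightarrow> 'b) \<Rightarrow> bool" where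
  "homothetic_immersion M N \<psi> \<longleftrightarrow> smooth_map M N \<psi> \<and>
     (\<forall>c\<in>params M. \<forall>d\<in>params N. \<forall>u\<in>loc_dom c d \<psi>. inj (dloc c d \<psi> u)) \<and>
     (\<exists>r>0. \<forall>c\<in>params M. \<forall>d\<in>params N. \<forall>u\<in>loc_dom c d \<psi>. \<forall>v w.
        pullback_form N c d \<psi> u v w = r * pullback_metric M (snd c) u v w)"

section \<open>The manifolds in question\<close>

text \<open>The image of \<open>p\<close>, carrying the flat metric for which \<open>p\<close> is a Riemannian covering. It is
  parametrized by the restrictions of \<open>p\<close> to the open sets on which \<open>p\<close> is injective.\<close>

definition flat_quotient :: "('e::euclidean_space \<Rightarrow> 'a) \<Rightarrow> ('e, 'a) riem" where
  "flat_quotient p = \<lparr>points = range p, params = {(U, p) |U. open U \<and> inj_on p U},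
     pullback_metric = (\<lambda>_ _. inner)\<rparr>"

definition unit_circle :: "(real, complex) riem" where
  "unit_circle = flat_quotient cis"

definition cylinder :: "(real \<times> real, real \<times> complex) riem" where
  "cylinder = flat_quotient (\<lambda>(s, t). (s, cis t))"

text \<open>The class of \<open>s\<close> in \<open>\<real>/\<langle>T\<rangle>\<close>.\<close>

definition coset_of :: "real \<Rightarrow> real \<Rightarrow> real set" where
  "coset_of T s = range (\<lambda>n::int. s + of_int n * T)"

definition torus :: "real \<Rightarrow> (real \<times> real, real set \<times> complex) riem" where
  "torus T = flat_quotient (\<lambda>(s, t). (coset_of T s, cis t))"

text \<open>The inverses of the stereographic projections from the poles \<open>(\<sigma>, 0)\<close>, \<open>\<sigma> = \<plusminus>1\<close>, of the
  unit sphere in \<open>\<real> \<oplus> \<complex>\<close>.\<close>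

definition inv_stereographic :: "real \<Rightarrow> complex \<Rightarrow> real \<times> complex" where
  "inv_stereographic \<sigma> z =
     (\<sigma> * (((norm z)\<^sup>2 - 1) / ((norm z)\<^sup>2 + 1)), (2 / ((norm z)\<^sup>2 + 1)) *\<^sub>R z)"

definition unit_sphere :: "(complex, real \<times> complex) riem" where
  "unit_sphere = \<lparr>points = sphere 0 1,
     params = {(UNIV, inv_stereographic 1), (UNIV, inv_stereographic (-1))},
     pullback_metric = (\<lambda>p z v w. frechet_derivative p (at z) v \<bullet> frechet_derivative p (at z) w)\<rparr>"

section \<open>The pendulum equation\<close>

definition pendulum_solution :: "real \<Rightarrow> (real \<Rightarrow> real) \<Rightarrow> bool" where
  "pendulum_solution \<kappa> \<theta> \<longleftrightarrow> (\<exists>\<theta>' \<theta>''. \<forall>t. (\<theta> has_real_derivative \<theta>' t) (at t) \<and>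
     (\<theta>' has_real_derivative \<theta>'' t) (at t) \<and> \<theta>'' t + \<kappa>\<^sup>2 * sin (\<theta> t) = 0)"

section \<open>These are Riemannian manifolds\<close>

lemma Ck_on_cong:
  assumes "open S" "\<And>x. x \<in> S \<Longrightarrow> f x = g x" "Ck_on n f S"
  shows "Ck_on n g S"
  using assms(2,3)
proof (induction n arbitrary: f g)
  case 0
  then show ?case by (simp cong: continuous_on_cong)
next
  case (Suc n)
  have *: "(g has_derivative frechet_derivative f (at x)) (at x)" if "x \<in> S" for x
  proof -
    have "(f has_derivative frechet_derivative f (at x)) (at x)"
      using Suc.prems that by (simp add: frechet_derivative_works)
    then show ?thesis
      using has_derivative_transform_within_open[OF _ assms(1) that] Suc.prems(1) by blast
  qed
  have "Ck_on n (\<lambda>x. frechet_derivative g (at x) v) S" for v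
    by (rule Suc.IH[of "\<lambda>x. frechet_derivative f (at x) v"])
      (use frechet_derivative_at[OF *] Suc.prems in auto)
  then show ?case using * by (auto simp: differentiable_def)
qed

lemma Ck_on_SucI:
  assumes "open S" "\<And>x. x \<in> S \<Longrightarrow> (f has_derivative f' x) (at x)" "\<And>v. Ck_on n (\<lambda>x. f' x v) S"
  shows "Ck_on (Suc n) f S"
proof -
  have "Ck_on n (\<lambda>x. frechet_derivative f (at x) v) S" for v
    by (rule Ck_on_cong[OF assms(1) _ assms(3)]) (use frechet_derivative_at[OF assms(2)] in auto)
  then show ?thesis using assms(2) by (auto simp: differentiable_def)
qed

lemma Ck_on_SucD: "Ck_on (Suc n) f S \<Longrightarrow> Ck_on n f S"
proof (induction n arbitrary: f)
  case 0
  then have "\<forall>x\<in>S. isCont f x"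
    by (simp add: differentiable_imp_continuous_within)
  then show ?case by (simp add: continuous_at_imp_continuous_on)
next
  case (Suc n)
  from Suc.prems have "\<forall>x\<in>S. f differentiable (at x)"
    and *: "Ck_on (Suc n) (\<lambda>x. frechet_derivative f (at x) v) S" for v
    unfolding Ck_on.simps(2)[of "Suc n"] by blast+
  then show ?case using Suc.IH[OF *] by simp
qed

lemma Ck_on_local:
  assumes "\<And>x. x \<in> S \<Longrightarrow> \<exists>T. open T \<and> x \<in> T \<and> T \<subseteq> S \<and> Ck_on n f T"
  shows "Ck_on n f S"
  using assms
proof (induction n arbitrary: f)
  case 0
  have "isCont f x" if x: "x \<in> S" for x
  proof -
    obtain T where "open T" "x \<in> T" "Ck_on 0 f T" using 0 x by blast
    then show ?thesis by (simp add: continuous_on_eq_continuous_at)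
  qed
  then show ?case by (simp add: continuous_at_imp_continuous_on)
next
  case (Suc n)
  have *: "\<exists>T. open T \<and> x \<in> T \<and> T \<subseteq> S \<and> f differentiable (at x) \<and>
      (\<forall>v. Ck_on n (\<lambda>x. frechet_derivative f (at x) v) T)" if x: "x \<in> S" for x
  proof -
    obtain T where "open T" "x \<in> T" "T \<subseteq> S" "Ck_on (Suc n) f T" using Suc.prems x by blast
    then show ?thesis by (intro exI[of _ T]) simp
  qed
  have "Ck_on n (\<lambda>x. frechet_derivative f (at x) v) S" for v
    by (rule Suc.IH) (use * in blast)
  then show ?case using * by auto
qed

lemma Ck_on_const: "open S \<Longrightarrow> Ck_on n (\<lambda>_. c) S"
proof (induction n arbitrary: c)
  case (Suc n)
  then show ?case by (intro Ck_on_SucI[where f' = "\<lambda>_ _. 0"]) auto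
qed simp

lemma Ck_on_linear:
  assumes "open S" "bounded_linear L"
  shows "Ck_on n L S"
proof (cases n)
  case 0
  then show ?thesis using assms(2) by (simp add: linear_continuous_on)
next
  case (Suc m)
  show ?thesis unfolding Suc
    by (rule Ck_on_SucI[where f' = "\<lambda>_. L"])
      (use assms in \<open>auto intro: Ck_on_const bounded_linear_imp_has_derivative\<close>)
qed

lemma Ck_on_linear_comp:
  assumes "open S" "bounded_linear L"
  shows "Ck_on n f S \<Longrightarrow> Ck_on n (\<lambda>x. L (f x)) S"
proof (induction n arbitrary: f)
  case 0
  then show ?case using assms(2) by (simp add: bounded_linear.continuous_on)
next
  case (Suc n)
  show ?case
  proof (rule Ck_on_SucI[OF assms(1)])
    show "((\<lambda>x. L (f x)) has_derivative (\<lambda>v. L (frechet_derivative f (at x) v))) (at x)"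
      if "x \<in> S" for x
      by (rule bounded_linear.has_derivative[OF assms(2)])
        (use Suc.prems that in \<open>simp add: frechet_derivative_works\<close>)
    show "Ck_on n (\<lambda>x. L (frechet_derivative f (at x) v)) S" for v
      using Suc by simp
  qed
qed

lemma Ck_on_add:
  assumes "open S"
  shows "Ck_on n f S \<Longrightarrow> Ck_on n g S \<Longrightarrow> Ck_on n (\<lambda>x. f x + g x) S"
proof (induction n arbitrary: f g)
  case 0
  then show ?case by (simp add: continuous_on_add)
next
  case (Suc n)
  show ?case
    by (rule Ck_on_SucI[where
          f' = "\<lambda>x v. frechet_derivative f (at x) v + frechet_derivative g (at x) v"])
      (use Suc assms in \<open>auto intro!: has_derivative_add simp: frechet_derivative_works\<close>)
qed

lemma Ck_on_bilinear:
  assumes "open S" "bounded_bilinear B"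
  shows "Ck_on n f S \<Longrightarrow> Ck_on n g S \<Longrightarrow> Ck_on n (\<lambda>x. B (f x) (g x)) S"
proof (induction n arbitrary: f g)
  case 0
  then show ?case using assms(2) by (simp add: bounded_bilinear.continuous_on)
next
  case (Suc n)
  note * = Suc.prems[THEN Ck_on_SucD]
  show ?case
    by (rule Ck_on_SucI[where
          f' = "\<lambda>x v. B (f x) (frechet_derivative g (at x) v) + B (frechet_derivative f (at x) v) (g x)"])
      (use Suc * assms in
        \<open>auto intro!: bounded_bilinear.FDERIV Ck_on_add simp: frechet_derivative_works\<close>)
qed

lemma Ck_on_inverse:
  fixes f :: "'e::euclidean_space \<Rightarrow> real"
  assumes "open S" "\<And>x. x \<in> S \<Longrightarrow> f x \<noteq> 0"
  shows "Ck_on n f S \<Longrightarrow> Ck_on n (\<lambda>x. inverse (f x)) S"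
proof (induction n)
  case 0
  then show ?case using assms(2) by (simp add: continuous_on_inverse)
next
  case (Suc n)
  have *: "Ck_on n (\<lambda>x. - (inverse (f x) * frechet_derivative f (at x) v * inverse (f x))) S" for v
  proof (rule Ck_on_linear_comp[OF assms(1) bounded_linear_minus[OF bounded_linear_ident]])
    show "Ck_on n (\<lambda>x. inverse (f x) * frechet_derivative f (at x) v * inverse (f x)) S"
      by (intro Ck_on_bilinear[OF assms(1) bounded_bilinear_mult])
        (use Suc Ck_on_SucD in auto)
  qed
  show ?case
    by (rule Ck_on_SucI[OF assms(1) _ *])
      (use Suc.prems assms(2) in \<open>auto intro!: Deriv.has_derivative_inverse simp: frechet_derivative_works\<close>)
qed

lemma Ck_on_Pair:
  assumes "open S" "Ck_on n f S" "Ck_on n g S"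
  shows "Ck_on n (\<lambda>x. (f x, g x)) S"
proof -
  have "Ck_on n (\<lambda>x. (f x, 0) + (0, g x)) S"
    using assms by (intro Ck_on_add Ck_on_linear_comp[of S "\<lambda>a. (a, 0)"]
        Ck_on_linear_comp[of S "\<lambda>a. (0, a)"] bounded_linear_Pair bounded_linear_ident
        bounded_linear_zero) auto
  then show ?thesis by simp
qed

lemma hausdorffI:
  assumes "(U, p) \<in> params M" "(V, q) \<in> params M" "U' \<subseteq> U" "V' \<subseteq> V" "open U'" "open V'"
    "x \<in> p ` U'" "y \<in> q ` V'" "p ` U' \<inter> q ` V' = {}"
  shows "\<exists>(U, p)\<in>params M. \<exists>(V, q)\<in>params M. \<exists>U'\<subseteq>U. \<exists>V'\<subseteq>V. open U' \<and> open V' \<and>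
           x \<in> p ` U' \<and> y \<in> q ` V' \<and> p ` U' \<inter> q ` V' = {}"
  apply (rule bexI[OF _ assms(1)])
  apply (unfold prod.case)
  apply (rule bexI[OF _ assms(2)])
  apply (unfold prod.case)
  using assms(3-) by blast

lemma riemannian_manifold_flat_quotient:
  fixes p :: "'e::euclidean_space \<Rightarrow> 'a"
  assumes eq: "\<And>x y. p x = p y \<longleftrightarrow> x - y \<in> G"
    and "\<epsilon> > 0" and disc: "\<And>x. x \<in> G \<Longrightarrow> norm x < \<epsilon> \<Longrightarrow> x = 0"
  shows "riemannian_manifold (flat_quotient p)"
proof -
  let ?M = "flat_quotient p"
  have diff: "x - y \<in> G" if "x \<in> G" "y \<in> G" for x y
    using eq[of x 0] eq[of y 0] eq[of x y] that by simp
  have shift: "p (x + g) = p x" if "g \<in> G" for x g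
    using eq that by simp
  have inj: "inj_on p (ball a r)" if "r \<le> \<epsilon>/2" for a r
  proof (rule inj_onI)
    fix x y assume "x \<in> ball a r" "y \<in> ball a r" "p x = p y"
    moreover from this have "dist x y < \<epsilon>"
      using that dist_triangle_half_l[of x a \<epsilon> y] by (auto simp: dist_commute)
    ultimately show "x = y" using disc[of "x - y"] eq by (simp add: dist_norm)
  qed
  have cover: "\<exists>C\<subseteq>params ?M. countable C \<and> points ?M = (\<Union>(U, p)\<in>C. p ` U)"
  proof -
    have "\<And>S. S \<in> range (\<lambda>a. ball a (\<epsilon>/2)) \<Longrightarrow> open (S :: 'e set)" by auto
    from Lindelof[OF this] obtain F where
      F: "F \<subseteq> range (\<lambda>a. ball a (\<epsilon>/2))" "countable F" "\<Union>F = (\<Union>(a::'e). ball a (\<epsilon>/2))"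
      by auto
    have "(\<Union>(a::'e). ball a (\<epsilon>/2)) = UNIV"
      using \<open>\<epsilon> > 0\<close> by (metis (no_types, lifting) UNIV_I UN_I centre_in_ball half_gt_zero subsetI top.extremum_uniqueI)
    with F have "\<Union>F = UNIV" by simp
    then have "range p = (\<Union>U\<in>F. p ` U)" by (metis image_Union)
    moreover have "(\<lambda>U. (U, p)) ` F \<subseteq> params ?M"
      using F(1) inj[of "\<epsilon>/2"] by (auto simp: flat_quotient_def)
    ultimately show ?thesis
      using F(2) by (intro exI[of _ "(\<lambda>U. (U, p)) ` F"]) (auto simp: flat_quotient_def)
  qed
  have haus: "\<exists>(U, p)\<in>params ?M. \<exists>(V, q)\<in>params ?M. \<exists>U'\<subseteq>U. \<exists>V'\<subseteq>V. open U' \<and> open V' \<and>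
           x \<in> p ` U' \<and> y \<in> q ` V' \<and> p ` U' \<inter> q ` V' = {}"
    if "x \<in> points ?M" "y \<in> points ?M" "x \<noteq> y" for x y
  proof -
    from that obtain a b where ab: "x = p a" "y = p b" "a - b \<notin> G"
      using eq by (auto simp: flat_quotient_def)
    obtain \<delta> where \<delta>: "\<delta> > 0" "\<And>g. g \<in> G \<Longrightarrow> norm (a - b - g) \<ge> \<delta>"
    proof (cases "\<exists>g\<in>G. norm (a - b - g) < \<epsilon>/2")
      case True
      then obtain g where g: "g \<in> G" "norm (a - b - g) < \<epsilon>/2" by blast
      have "norm (a - b - h) \<ge> min (norm (a - b - g)) (\<epsilon>/2)" if "h \<in> G" for h
      proof (rule ccontr)
        assume less: "\<not> ?thesis"
        have "norm (g - h) = norm ((a - b - h) - (a - b - g))" by simp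
        also have "\<dots> \<le> norm (a - b - h) + norm (a - b - g)" by (rule norm_triangle_ineq4)
        also have "\<dots> < \<epsilon>" using less g(2) by simp
        finally have "g = h" using disc[OF diff[OF g(1) that]] by simp
        then show False using less by simp
      qed
      moreover have "min (norm (a - b - g)) (\<epsilon>/2) > 0" using ab(3) g(1) \<open>\<epsilon> > 0\<close> by auto
      ultimately show ?thesis using that by blast
    next
      case False
      then show ?thesis using that[of "\<epsilon>/2"] \<open>\<epsilon> > 0\<close> by force
    qed
    define r where "r = min (\<delta>/2) (\<epsilon>/2)"
    have r: "r > 0" "r \<le> \<epsilon>/2" "2 * r \<le> \<delta>" using \<delta>(1) \<open>\<epsilon> > 0\<close> by (auto simp: r_def)
    have "p ` ball a r \<inter> p ` ball b r = {}"
    proof (rule ccontr)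
      assume "\<not> ?thesis"
      then obtain u v where uv: "u \<in> ball a r" "v \<in> ball b r" "p u = p v" by (auto simp: set_eq_iff)
      then have "norm (a - b - (u - v)) \<ge> \<delta>" using eq \<delta>(2) by blast
      moreover have "norm (a - b - (u - v)) = norm ((a - u) - (b - v))" by (simp add: algebra_simps)
      moreover have "\<dots> \<le> norm (a - u) + norm (b - v)" by (rule norm_triangle_ineq4)
      ultimately show False using uv r(3) by (simp add: dist_norm)
    qed
    moreover have "(ball a r, p) \<in> params ?M" "(ball b r, p) \<in> params ?M"
      using inj[OF r(2)] by (auto simp: flat_quotient_def)
    moreover have "x \<in> p ` ball a r" "y \<in> p ` ball b r" using ab r(1) by auto
    ultimately show ?thesis
      by - (rule hausdorffI[of "ball a r" p ?M "ball b r" p "ball a r" "ball b r"], auto)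
  qed
  have translation: "\<exists>\<delta>>0. \<exists>a. ball u \<delta> \<subseteq> loc_dom c d id \<and> (\<forall>x\<in>ball u \<delta>. loc c d id x = x + a)"
    if c: "c \<in> params ?M" and d: "d \<in> params ?M" and u: "u \<in> loc_dom c d id" for c d u
  proof -
    from c d obtain U V where cd: "c = (U, p)" "d = (V, p)" "open U" "open V" "inj_on p V"
      by (auto simp: flat_quotient_def)
    from u cd obtain v where v: "u \<in> U" "v \<in> V" "p u = p v" by (auto simp: loc_dom_def)
    obtain \<delta>1 where 1: "\<delta>1 > 0" "ball u \<delta>1 \<subseteq> U" using cd v open_contains_ball by metis
    obtain \<delta>2 where 2: "\<delta>2 > 0" "ball v \<delta>2 \<subseteq> V" using cd v open_contains_ball by metis
    have g: "v - u \<in> G" using v eq by metis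
    have *: "x \<in> U \<and> x + (v - u) \<in> V" if "x \<in> ball u (min \<delta>1 \<delta>2)" for x
    proof -
      have "x + (v - u) \<in> ball v \<delta>2" using that by (simp add: dist_norm algebra_simps)
      then show ?thesis using that 1 2 by auto
    qed
    have "x \<in> loc_dom c d id \<and> loc c d id x = x + (v - u)" if "x \<in> ball u (min \<delta>1 \<delta>2)" for x
    proof -
      have V: "x \<in> U" "x + (v - u) \<in> V" "p (x + (v - u)) = p x" using * that shift[OF g] by auto
      have "the_inv_into V p (p x) = x + (v - u)"
        by (rule the_inv_into_f_eq[OF cd(5) V(3) V(2)])
      moreover have "p x \<in> p ` V" using V by (metis image_eqI)
      ultimately show ?thesis using V(1) by (simp add: cd loc_dom_def loc_def)
    qed
    then show ?thesis using 1 2 by (intro exI[of _ "min \<delta>1 \<delta>2"] conjI exI[of _ "v - u"]) auto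
  qed
  have smooth: "smooth_map ?M ?M id"
    unfolding smooth_map_def Ck_map_def
  proof (intro allI ballI conjI)
    fix n c d assume cd: "c \<in> params ?M" "d \<in> params ?M"
    show "open (loc_dom c d id)"
      unfolding open_contains_ball using translation[OF cd] by blast
    show "Ck_on n (loc c d id) (loc_dom c d id)"
    proof (rule Ck_on_local)
      fix u assume "u \<in> loc_dom c d id"
      from translation[OF cd this] obtain \<delta> a where
        \<delta>: "\<delta> > 0" "ball u \<delta> \<subseteq> loc_dom c d id" "\<And>x. x \<in> ball u \<delta> \<Longrightarrow> loc c d id x = x + a" by blast
      have "Ck_on n (\<lambda>x. x + a) (ball u \<delta>)"
        by (intro Ck_on_add Ck_on_const Ck_on_linear) (auto simp: bounded_linear_ident)
      then have "Ck_on n (loc c d id) (ball u \<delta>)"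
        by (rule Ck_on_cong[rotated 2]) (use \<delta> in auto)
      then show "\<exists>T. open T \<and> u \<in> T \<and> T \<subseteq> loc_dom c d id \<and> Ck_on n (loc c d id) T"
        using \<delta> by (intro exI[of _ "ball u \<delta>"]) auto
    qed
  qed simp
  have isometry: "pullback_form ?M c d id u = pullback_metric ?M (snd c) u"
    if cd: "c \<in> params ?M" "d \<in> params ?M" and u: "u \<in> loc_dom c d id" for c d u
  proof -
    from translation[OF cd u] obtain \<delta> a where
      \<delta>: "\<delta> > 0" "\<And>x. x \<in> ball u \<delta> \<Longrightarrow> loc c d id x = x + a" by blast
    have "((\<lambda>x. x + a) has_derivative (\<lambda>v. v)) (at u)" by (auto intro!: derivative_eq_intros)
    then have "(loc c d id has_derivative (\<lambda>v. v)) (at u)"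
      by (rule has_derivative_transform_within_open[OF _ open_ball, of _ _ _ _ u \<delta>]) (use \<delta> in auto)
    then have "dloc c d id u = (\<lambda>v. v)" unfolding dloc_def using frechet_derivative_at by metis
    then show ?thesis by (simp add: fun_eq_iff pullback_form_def) (simp add: flat_quotient_def)
  qed
  have "bilinear (inner :: 'e \<Rightarrow> 'e \<Rightarrow> real)"
    by (auto simp: bilinear_def intro!: linearI simp: inner_add_left inner_add_right)
  then show ?thesis
    unfolding riemannian_manifold_def
    by (intro conjI cover smooth)
      (use haus isometry in \<open>auto simp: flat_quotient_def inner_commute smooth_on_def Ck_on_const\<close>)
qed

lemma cis_eq_iff: "cis s = cis t \<longleftrightarrow> (\<exists>n::int. s - t = 2 * pi * of_int n)"
proof -
  have "cis s = cis t \<longleftrightarrow> cis (s - t) = 1" by (simp add: cis_divide[symmetric])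
  also have "\<dots> \<longleftrightarrow> cos (s - t) = 1" using cos_one_sin_zero by (auto simp: complex_eq_iff)
  finally show ?thesis by (auto simp: cos_one_2pi_int mult_ac)
qed

lemma coset_of_eq_iff: "coset_of T s = coset_of T t \<longleftrightarrow> (\<exists>n::int. s - t = T * of_int n)"
proof
  assume "coset_of T s = coset_of T t"
  moreover have "s \<in> coset_of T s" unfolding coset_of_def by (rule range_eqI[of _ _ 0]) simp
  ultimately show "\<exists>n::int. s - t = T * of_int n" by (auto simp: coset_of_def mult.commute)
next
  assume "\<exists>n::int. s - t = T * of_int n"
  then obtain n :: int where n: "s = t + T * of_int n" by (auto simp: algebra_simps)
  have "coset_of T s \<subseteq> coset_of T t"
  proof
    fix x assume "x \<in> coset_of T s"
    then obtain m :: int where "x = s + of_int m * T" by (auto simp: coset_of_def)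
    then have "x = t + of_int (m + n) * T" using n by (simp add: algebra_simps)
    then show "x \<in> coset_of T t" unfolding coset_of_def by blast
  qed
  moreover have "coset_of T t \<subseteq> coset_of T s"
  proof
    fix x assume "x \<in> coset_of T t"
    then obtain m :: int where "x = t + of_int m * T" by (auto simp: coset_of_def)
    then have "x = s + of_int (m - n) * T" using n by (simp add: algebra_simps)
    then show "x \<in> coset_of T s" unfolding coset_of_def by blast
  qed
  ultimately show "coset_of T s = coset_of T t" by blast
qed

lemma multiple_small:
  fixes T :: real and n :: int
  assumes "T > 0" "\<bar>T * of_int n\<bar> < T" shows "n = 0"
proof -
  have "T * \<bar>of_int n\<bar> < T * 1" using assms by (simp add: abs_mult)
  then have "\<bar>real_of_int n\<bar> < 1" using assms(1) mult_less_cancel_left_pos by blast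
  then show ?thesis by linarith
qed

lemma riemannian_manifold_unit_circle: "riemannian_manifold unit_circle"
  unfolding unit_circle_def
proof (rule riemannian_manifold_flat_quotient)
  show "cis x = cis y \<longleftrightarrow> x - y \<in> range (\<lambda>n::int. 2 * pi * of_int n)" for x y
    by (auto simp: cis_eq_iff)
  show "x = 0" if "x \<in> range (\<lambda>n::int. 2 * pi * of_int n)" "norm x < 2 * pi" for x
    using that multiple_small[of "2 * pi"] by auto
qed simp

lemma riemannian_manifold_cylinder: "riemannian_manifold cylinder"
  unfolding cylinder_def
proof (rule riemannian_manifold_flat_quotient)
  let ?G = "{0} \<times> range (\<lambda>n::int. 2 * pi * of_int n)"
  show "(case x of (s, t) \<Rightarrow> (s, cis t)) = (case y of (s, t) \<Rightarrow> (s, cis t)) \<longleftrightarrow> x - y \<in> ?G" for x y :: "real \<times> real"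
    by (auto simp: cis_eq_iff split: prod.splits)
  show "x = 0" if "x \<in> ?G" "norm x < 2 * pi" for x :: "real \<times> real"
    using that multiple_small[of "2 * pi"] by (auto simp: zero_prod_def)
qed simp

lemma riemannian_manifold_torus:
  assumes "T > 0" shows "riemannian_manifold (torus T)"
  unfolding torus_def
proof (rule riemannian_manifold_flat_quotient)
  let ?G = "range (\<lambda>n::int. T * of_int n) \<times> range (\<lambda>n::int. 2 * pi * of_int n)"
  show "(case x of (s, t) \<Rightarrow> (coset_of T s, cis t)) = (case y of (s, t) \<Rightarrow> (coset_of T s, cis t))
      \<longleftrightarrow> x - y \<in> ?G" for x y :: "real \<times> real"
    by (auto simp: cis_eq_iff coset_of_eq_iff split: prod.splits)
  show "x = 0" if *: "x \<in> ?G" "norm x < min T (2 * pi)" for x :: "real \<times> real"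
  proof -
    obtain m n :: int where x: "x = (T * of_int m, 2 * pi * of_int n)"
      using *(1) by auto
    have "\<bar>T * of_int m\<bar> \<le> norm x" "\<bar>2 * pi * of_int n\<bar> \<le> norm x"
      using norm_fst_le[of "T * of_int m" "2 * pi * of_int n"]
        norm_snd_le[of "2 * pi * of_int n" "T * of_int m"] by (simp_all add: x)
    then have "m = 0" "n = 0"
      using *(2) assms multiple_small[of T m] multiple_small[of "2 * pi" n] by auto
    then show ?thesis by (simp add: x zero_prod_def)
  qed
qed (use assms in simp_all)

definition stereographic :: "real \<Rightarrow> real \<times> complex \<Rightarrow> complex" where
  "stereographic \<sigma> x = (1 / (1 - \<sigma> * fst x)) *\<^sub>R snd x"

lemma norm_sq_plus_1: "(norm (z::complex))\<^sup>2 + 1 > 0"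
  by (simp add: add_nonneg_pos)

lemma stereographic_denom:
  assumes "\<sigma>\<^sup>2 = 1"
  shows "1 - \<sigma> * fst (inv_stereographic \<sigma> z) = 2 / ((norm z)\<^sup>2 + 1)"
proof -
  have "\<sigma> * fst (inv_stereographic \<sigma> z) = \<sigma>\<^sup>2 * (((norm z)\<^sup>2 - 1) / ((norm z)\<^sup>2 + 1))"
    by (simp add: inv_stereographic_def power2_eq_square)
  also have "\<dots> = ((norm z)\<^sup>2 - 1) / ((norm z)\<^sup>2 + 1)" using assms by simp
  finally show ?thesis using norm_sq_plus_1[of z] by (simp add: field_simps)
qed

lemma stereographic_inverse:
  assumes "\<sigma>\<^sup>2 = 1" shows "stereographic \<sigma> (inv_stereographic \<sigma> z) = z"
proof -
  have "1 / (2 / ((norm z)\<^sup>2 + 1)) * (2 / ((norm z)\<^sup>2 + 1)) = 1"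
    using norm_sq_plus_1[of z] by simp
  then show ?thesis
    unfolding stereographic_def stereographic_denom[OF assms]
    by (simp only: inv_stereographic_def snd_conv scaleR_scaleR scaleR_one)
qed

lemma inj_inv_stereographic: "\<sigma>\<^sup>2 = 1 \<Longrightarrow> inj (inv_stereographic \<sigma>)"
  by (metis injI stereographic_inverse)

lemma range_inv_stereographic:
  assumes "\<sigma>\<^sup>2 = 1" shows "range (inv_stereographic \<sigma>) = sphere 0 1 - {(\<sigma>, 0)}"
proof
  have sph: "x \<in> sphere 0 1 \<longleftrightarrow> (fst x)\<^sup>2 + (norm (snd x))\<^sup>2 = 1" for x :: "real \<times> complex"
    by (cases x) (simp add: norm_Pair)
  show "range (inv_stereographic \<sigma>) \<subseteq> sphere 0 1 - {(\<sigma>, 0)}"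
  proof (intro subsetI, elim rangeE, intro DiffI)
    fix x and z :: complex
    assume x: "x = inv_stereographic \<sigma> z"
    define N where "N = (norm z)\<^sup>2"
    have N: "N + 1 > 0" using norm_sq_plus_1[of z] by (simp add: N_def)
    have "(fst (inv_stereographic \<sigma> z))\<^sup>2 + (norm (snd (inv_stereographic \<sigma> z)))\<^sup>2 =
        ((N - 1) / (N + 1))\<^sup>2 + (2 / (N + 1))\<^sup>2 * N"
      using assms by (simp add: inv_stereographic_def power_mult_distrib N_def power_divide)
    also have "\<dots> = 1"
      using N by (simp add: power_divide add_divide_distrib[symmetric] divide_simps) algebra
    finally show "x \<in> sphere 0 1" using sph x by blast
    show "x \<notin> {(\<sigma>, 0)}"
      using stereographic_denom[OF assms, of z] assms norm_sq_plus_1[of z] x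
      by (auto simp: power2_eq_square)
  qed
  show "sphere 0 1 - {(\<sigma>, 0)} \<subseteq> range (inv_stereographic \<sigma>)"
  proof
    fix x :: "real \<times> complex" assume x: "x \<in> sphere 0 1 - {(\<sigma>, 0)}"
    obtain h w where hw: "x = (h, w)" by (cases x)
    have n: "h\<^sup>2 + (norm w)\<^sup>2 = 1" using x sph[of x] hw by auto
    define g where "g = \<sigma> * h"
    have h: "h = \<sigma> * g" using assms by (simp add: g_def power2_eq_square mult.assoc[symmetric])
    have g2: "g\<^sup>2 = h\<^sup>2" using assms by (simp add: g_def power_mult_distrib)
    have ne: "g \<noteq> 1"
    proof
      assume "g = 1"
      then have "h = \<sigma>" "w = 0" using h n g2 by auto
      then show False using x hw by auto
    qed
    have "g\<^sup>2 \<le> 1" using n g2 zero_le_power2[of "norm w"] by linarith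
    then have "g < 1" using ne abs_square_le_1[of g] by auto
    define z where "z = (1 / (1 - g)) *\<^sub>R w"
    have "(norm z)\<^sup>2 = (norm w)\<^sup>2 / (1 - g)\<^sup>2" by (simp add: z_def power_mult_distrib power_divide)
    also have "(norm w)\<^sup>2 = (1 - g) * (1 + g)" using n g2 by (simp add: power2_eq_square algebra_simps)
    finally have N: "(norm z)\<^sup>2 = (1 + g) / (1 - g)" using ne by (simp add: power2_eq_square)
    have "(norm z)\<^sup>2 + 1 = 2 / (1 - g)" "(norm z)\<^sup>2 - 1 = 2 * g / (1 - g)"
      unfolding N using ne by (auto simp: field_simps)
    then have "inv_stereographic \<sigma> z = x"
      using ne by (simp add: inv_stereographic_def z_def hw h)
    then show "x \<in> range (inv_stereographic \<sigma>)" by blast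
  qed
qed

lemma smooth_on_inv_stereographic: "Ck_on n (inv_stereographic \<sigma>) UNIV"
proof -
  have N: "Ck_on n (\<lambda>z::complex. z \<bullet> z) UNIV"
    by (intro Ck_on_bilinear[OF _ bounded_bilinear_inner] Ck_on_linear) (auto simp: bounded_linear_ident)
  have I: "Ck_on n (\<lambda>z::complex. inverse (z \<bullet> z + 1)) UNIV"
    by (intro Ck_on_inverse Ck_on_add N Ck_on_const)
      (use norm_sq_plus_1[unfolded power2_norm_eq_inner] in \<open>auto simp: less_le\<close>)
  have "Ck_on n (\<lambda>z::complex. (\<sigma> * ((z \<bullet> z + (-1)) * inverse (z \<bullet> z + 1)), (2 * inverse (z \<bullet> z + 1)) *\<^sub>R z)) UNIV"
    by (intro Ck_on_Pair Ck_on_bilinear[OF _ bounded_bilinear_mult] Ck_on_add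
        Ck_on_bilinear[OF _ bounded_bilinear_scaleR] I N Ck_on_const Ck_on_linear)
      (auto simp: bounded_linear_ident)
  then show ?thesis
    by (rule Ck_on_cong[rotated 2]) (auto simp: inv_stereographic_def power2_norm_eq_inner divide_inverse)
qed

lemma inv_stereographic_has_derivative:
  "(inv_stereographic \<sigma> has_derivative frechet_derivative (inv_stereographic \<sigma>) (at z)) (at z)"
  using smooth_on_inv_stereographic[of 1 \<sigma>] by (simp add: frechet_derivative_works)

lemma inj_derivative_inv_stereographic:
  assumes "\<sigma>\<^sup>2 = 1" "frechet_derivative (inv_stereographic \<sigma>) (at z) v = 0"
  shows "v = 0"
proof -
  let ?D = "frechet_derivative (inv_stereographic \<sigma>) (at z)"
  have "1 - \<sigma> * fst (inv_stereographic \<sigma> z) \<noteq> 0"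
    using stereographic_denom[OF assms(1), of z] norm_sq_plus_1[of z] by simp
  then have "(stereographic \<sigma>) differentiable (at (inv_stereographic \<sigma> z))"
    unfolding stereographic_def differentiable_def
    by (intro exI) (rule derivative_eq_intros refl | simp)+
  then obtain E where E: "(stereographic \<sigma> has_derivative E) (at (inv_stereographic \<sigma> z))"
    by (auto simp: differentiable_def)
  have "((\<lambda>z. stereographic \<sigma> (inv_stereographic \<sigma> z)) has_derivative (\<lambda>v. E (?D v))) (at z)"
    by (rule has_derivative_compose[OF inv_stereographic_has_derivative E])
  then have "((\<lambda>z. z) has_derivative (\<lambda>v. E (?D v))) (at z)"
    using stereographic_inverse[OF assms(1)] by simp
  then have "(\<lambda>v. E (?D v)) = (\<lambda>v. v)" by (rule has_derivative_unique[OF _ has_derivative_ident])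
  then have "E (?D v) = v" by metis
  then show ?thesis
    using assms(2) E by (simp add: has_derivative_bounded_linear linear_0 bounded_linear.linear)
qed

lemma riemannian_manifold_unit_sphere: "riemannian_manifold unit_sphere"
proof -
  let ?M = unit_sphere
  let ?P = "\<lambda>\<sigma>. (UNIV, inv_stereographic \<sigma>)"
  have par: "\<exists>\<sigma>. \<sigma>\<^sup>2 = 1 \<and> c = ?P \<sigma>" if "c \<in> params ?M" for c
  proof -
    have "c = ?P 1 \<or> c = ?P (-1)" using that by (simp add: unit_sphere_def)
    then show ?thesis
      using power2_minus[of "1::real"] one_power2[where 'a = real] by metis
  qed
  have parI: "?P 1 \<in> params ?M" "?P (-1) \<in> params ?M" by (auto simp: unit_sphere_def)
  have pts: "points ?M = sphere 0 1" by (simp add: unit_sphere_def)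
  have met: "pullback_metric ?M p z v w =
      frechet_derivative p (at z) v \<bullet> frechet_derivative p (at z) w" for p z v w
    by (simp add: unit_sphere_def)
  have basic: "\<forall>(U, p)\<in>params ?M. open U \<and> inj_on p U \<and> p ` U \<subseteq> points ?M"
  proof (intro ballI case_prodI2)
    fix c U p assume "c \<in> params ?M" "c = (U, p)"
    with par obtain \<sigma> where \<sigma>: "\<sigma>\<^sup>2 = 1" "U = UNIV" "p = inv_stereographic \<sigma>" by blast
    then show "open U \<and> inj_on p U \<and> p ` U \<subseteq> points ?M"
      unfolding pts using inj_inv_stereographic[OF \<sigma>(1)] range_inv_stereographic[OF \<sigma>(1)] by simp
  qed
  have un: "range (inv_stereographic 1) \<union> range (inv_stereographic (-1)) = sphere 0 1"
    using range_inv_stereographic[of 1] range_inv_stereographic[of "-1"] by auto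
  have cover: "\<exists>C\<subseteq>params ?M. countable C \<and> points ?M = (\<Union>(U, p)\<in>C. p ` U)"
    by (rule exI[of _ "params ?M"]) (use un in \<open>auto simp: unit_sphere_def\<close>)
  have haus: "\<exists>(U, p)\<in>params ?M. \<exists>(V, q)\<in>params ?M. \<exists>U'\<subseteq>U. \<exists>V'\<subseteq>V. open U' \<and> open V' \<and>
           x \<in> p ` U' \<and> y \<in> q ` V' \<and> p ` U' \<inter> q ` V' = {}"
    if xy: "x \<in> points ?M" "y \<in> points ?M" "x \<noteq> y" for x y
  proof -
    obtain p q where pq: "(UNIV, p) \<in> params ?M" "(UNIV, q) \<in> params ?M" "x \<in> range p" "y \<in> range q"
      using xy un parI unfolding pts by blast
    have cont: "continuous_on UNIV r" if "(UNIV, r) \<in> params ?M" for r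
      using par[OF that] smooth_on_inv_stereographic[of 0] by auto
    obtain X Y where XY: "open X" "open Y" "x \<in> X" "y \<in> Y" "X \<inter> Y = {}"
      using hausdorff[OF xy(3)] by blast
    have "open (p -` X)" "open (q -` Y)"
      using cont pq XY by (auto simp: open_vimage)
    moreover have "x \<in> p ` (p -` X)" "y \<in> q ` (q -` Y)" "p ` (p -` X) \<inter> q ` (q -` Y) = {}"
      using pq XY by auto
    ultimately show ?thesis using pq
      by - (rule hausdorffI[of UNIV p ?M UNIV q "p -` X" "q -` Y"], auto)
  qed
  have smooth1: "open (loc_dom c d id) \<and> Ck_on n (loc c d id) (loc_dom c d id)"
    if cd: "c \<in> params ?M" "d \<in> params ?M" for n c d
  proof (cases "c = d")
    case True
    with par[OF cd(1)] obtain \<sigma> where \<sigma>: "\<sigma>\<^sup>2 = 1" "c = ?P \<sigma>" "d = ?P \<sigma>" by blast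
    then have "loc_dom c d id = UNIV" "loc c d id = (\<lambda>u. u)"
      by (auto simp: loc_dom_def loc_def the_inv_into_f_f inj_inv_stereographic)
    then show ?thesis by (simp add: Ck_on_linear bounded_linear_ident)
  next
    case False
    with cd have "c = ?P 1 \<and> d = ?P (- 1) \<or> c = ?P (- 1) \<and> d = ?P (- (- 1))"
      unfolding unit_sphere_def by auto
    then obtain \<sigma> where \<sigma>: "\<sigma>\<^sup>2 = 1" "c = ?P \<sigma>" "d = ?P (- \<sigma>)"
      using power2_minus[of "1::real"] one_power2[where 'a = real] by metis
    have tr: "inv_stereographic (- \<sigma>) (inverse (z \<bullet> z) *\<^sub>R z) = inv_stereographic \<sigma> z" if "z \<noteq> 0" for z
    proof -
      define N where "N = z \<bullet> z"
      have N: "N > 0" using that unfolding N_def by (rule inner_gt_zero_iff[THEN iffD2])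
      have n: "(norm (inverse N *\<^sub>R z))\<^sup>2 = inverse N" "(norm z)\<^sup>2 = N"
        using N unfolding power2_norm_eq_inner N_def[symmetric]
        by (auto simp: N_def[symmetric])
      show ?thesis unfolding inv_stereographic_def N_def[symmetric] n
        using N by (auto simp: divide_simps) (auto simp: algebra_simps)
    qed
    have z0: "inv_stereographic \<sigma> 0 = (- \<sigma>, 0)" by (simp add: inv_stereographic_def)
    have dom: "loc_dom c d id = - {0}"
    proof -
      have "inv_stereographic \<sigma> z \<in> range (inv_stereographic (- \<sigma>)) \<longleftrightarrow> z \<noteq> 0" for z
        using tr[of z] z0 range_inv_stereographic[of "- \<sigma>"] \<sigma>(1) by (metis Diff_iff insertI1 power2_minus rangeI)
      then show ?thesis by (auto simp: loc_dom_def \<sigma>)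
    qed
    have loc: "inverse (z \<bullet> z) *\<^sub>R z = loc c d id z" if "z \<in> - {0}" for z
      using the_inv_into_f_f[OF inj_inv_stereographic[of "- \<sigma>"], of "inverse (z \<bullet> z) *\<^sub>R z"] tr[of z] that \<sigma>
      by (simp add: loc_def)
    have "Ck_on n (\<lambda>z::complex. inverse (z \<bullet> z) *\<^sub>R z) (- {0})"
      by (intro Ck_on_bilinear[OF _ bounded_bilinear_scaleR] Ck_on_inverse
          Ck_on_bilinear[OF _ bounded_bilinear_inner] Ck_on_linear)
        (auto simp: bounded_linear_ident)
    then have "Ck_on n (loc c d id) (- {0})"
      by (rule Ck_on_cong[rotated 2]) (use loc in auto)
    then show ?thesis by (auto simp: dom)
  qed
  then have smooth: "smooth_map ?M ?M id" by (auto simp: smooth_map_def Ck_map_def)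
  have isometry: "pullback_form ?M c d id u = pullback_metric ?M (snd c) u"
    if cd: "c \<in> params ?M" "d \<in> params ?M" and u: "u \<in> loc_dom c d id" for c d u
  proof -
    obtain \<sigma> \<tau> where st: "\<sigma>\<^sup>2 = 1" "c = ?P \<sigma>" "\<tau>\<^sup>2 = 1" "d = ?P \<tau>" using par cd by metis
    have op: "open (loc_dom c d id)" using smooth1[OF cd] by blast
    have "(loc c d id has_derivative dloc c d id u) (at u)"
      using smooth1[OF cd, of 1] u by (simp add: dloc_def frechet_derivative_works)
    then have "((\<lambda>x. inv_stereographic \<tau> (loc c d id x)) has_derivative
        (\<lambda>v. frechet_derivative (inv_stereographic \<tau>) (at (loc c d id u)) (dloc c d id u v))) (at u)"
      by (rule has_derivative_compose[OF _ inv_stereographic_has_derivative])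
    then have "(inv_stereographic \<sigma> has_derivative
        (\<lambda>v. frechet_derivative (inv_stereographic \<tau>) (at (loc c d id u)) (dloc c d id u v))) (at u)"
      by (rule has_derivative_transform_within_open[OF _ op u])
        (auto simp: st loc_dom_def loc_def f_the_inv_into_f inj_inv_stereographic)
    then have "frechet_derivative (inv_stereographic \<sigma>) (at u) =
        (\<lambda>v. frechet_derivative (inv_stereographic \<tau>) (at (loc c d id u)) (dloc c d id u v))"
      using frechet_derivative_at by metis
    then show ?thesis by (simp add: fun_eq_iff pullback_form_def met st)
  qed
  have lin: "linear (frechet_derivative (inv_stereographic \<sigma>) (at u))" for \<sigma> u
    using inv_stereographic_has_derivative has_derivative_bounded_linear bounded_linear.linear by blast
  have form: "\<forall>(U, p)\<in>params ?M. \<forall>u\<in>U. bilinear (pullback_metric ?M p u) \<and>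
        (\<forall>v w. pullback_metric ?M p u v w = pullback_metric ?M p u w v) \<and>
        (\<forall>v. v \<noteq> 0 \<longrightarrow> pullback_metric ?M p u v v > 0)"
  proof safe
    fix U p u assume "(U, p) \<in> params ?M"
    from par[OF this] obtain \<sigma> where \<sigma>: "\<sigma>\<^sup>2 = 1" "p = inv_stereographic \<sigma>" by auto
    show "bilinear (pullback_metric ?M p u)"
      unfolding bilinear_def met \<sigma>
      by (auto intro!: linearI simp: linear_add[OF lin] linear_cmul[OF lin] inner_add_left inner_add_right)
    show "pullback_metric ?M p u v w = pullback_metric ?M p u w v" for v w
      by (simp add: met inner_commute)
    show "pullback_metric ?M p u v v > 0" if "v \<noteq> 0" for v
      using inj_derivative_inv_stereographic[OF \<sigma>(1)] that unfolding met \<sigma> inner_gt_zero_iff by blast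
  qed
  have smooth_metric: "\<forall>(U, p)\<in>params ?M. \<forall>v w. smooth_on (\<lambda>u. pullback_metric ?M p u v w) U"
  proof safe
    fix U p v w assume "(U, p) \<in> params ?M"
    from par[OF this] obtain \<sigma> where \<sigma>: "U = UNIV" "p = inv_stereographic \<sigma>" by auto
    have "Ck_on n (\<lambda>u. frechet_derivative (inv_stereographic \<sigma>) (at u) v) UNIV" for n v
      using smooth_on_inv_stereographic[of "Suc n" \<sigma>] by simp
    then show "smooth_on (\<lambda>u. pullback_metric ?M p u v w) U"
      unfolding smooth_on_def met \<sigma> by (auto intro!: Ck_on_bilinear[OF _ bounded_bilinear_inner])
  qed
  show ?thesis
    unfolding riemannian_manifold_def
    by (intro conjI basic cover smooth form smooth_metric) (use haus isometry in auto)
qed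

end

theory Submission
  imports Defs
begin

text \<open>
  Write \<open>\<kappa> = k\<close>. Everything is read off from the lift \<open>(s, t) \<mapsto> (cos \<alpha>(s), sin \<alpha>(s) e\<^bsup>i\<kappa>t\<^esup>)\<close> of
  \<open>\<phi>\<close> to the plane, viewed as a map into \<open>\<real> \<oplus> \<complex>\<close>: pulling the metric of the sphere back along
  \<open>\<phi>\<close> gives the inner products of the partial derivatives of the lift. Thus the energy density is
  \<open>\<alpha>'\<^sup>2 + \<kappa>\<^sup>2 sin\<^sup>2 \<alpha>\<close>, a function of \<open>s\<close> alone, with derivative \<open>\<alpha>' P\<close> where
  \<open>P = 2\<alpha>'' + \<kappa>\<^sup>2 sin 2\<alpha>\<close>. The lift maps the gradient to \<open>\<alpha>' P\<close> times the velocity of the curve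
  \<open>s \<mapsto> (cos \<alpha>, sin \<alpha> e\<^bsup>i\<kappa>t\<^esup>)\<close>, whose length is \<open>\<bar>\<alpha>'\<bar>\<close>. So \<open>\<phi>\<close> is infinity-harmonic if and only
  if \<open>\<alpha>' P = 0\<close> identically (\<open>infinity_harmonic_rotI\<close>, \<open>infinity_harmonic_rotD\<close>), while \<open>P = 0\<close> is
  the pendulum equation for \<open>2\<alpha>\<close>.

  It remains to see that \<open>\<alpha>' P = 0\<close> forces \<open>\<alpha>\<close> to be constant or \<open>P\<close> to vanish
  (\<open>constant_or_pendulum\<close>). The energy density is now constant. If some point \<open>s\<^sub>0\<close> has
  \<open>\<alpha>'(s\<^sub>0) = 0\<close> and \<open>sin 2\<alpha>(s\<^sub>0) = 0\<close>, then conservation of energy reads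
  \<open>\<alpha>'\<^sup>2 + \<kappa>\<^sup>2 sin\<^sup>2 \<alpha> = 0\<close> or \<open>\<alpha>'\<^sup>2 = \<kappa>\<^sup>2 cos\<^sup>2 \<alpha>\<close>; in the second case a Gronwall estimate for
  \<open>cos \<alpha>\<close> applies, and in both cases \<open>\<alpha>\<close> is constant (\<open>constant_if_equilibrium\<close>). If there is no
  such point, the open set where \<open>P \<noteq> 0\<close> is exactly the set where \<open>\<alpha>' = \<alpha>'' = 0\<close>, hence also
  closed, hence empty or the whole line.

  A constant \<open>\<alpha> = a\<close> with \<open>sin a \<noteq> 0\<close> gives the homothetic immersion of a circle of latitude, with
  factor \<open>(\<kappa> sin a)\<^sup>2\<close>; if \<open>sin a = 0\<close>, then \<open>2\<alpha>\<close> is an equilibrium of the pendulum. The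
  function \<open>2 arctan (e\<^bsup>\<kappa>s+A\<^esup>) - \<pi>/2\<close> satisfies \<open>\<alpha>' = \<kappa> cos \<alpha>\<close>, hence \<open>P = 0\<close>.
\<close>

section \<open>Functions of class \<open>C\<^sup>n\<close>\<close>

lemma Ck_on_subset: "Ck_on n f T \<Longrightarrow> S \<subseteq> T \<Longrightarrow> Ck_on n f S"
  by (induction n arbitrary: f) (auto intro: continuous_on_subset)

lemma Ck_on_imp_continuous_on: "Ck_on n f S \<Longrightarrow> continuous_on S f"
proof (induction n)
  case (Suc n)
  from Suc.IH[OF Ck_on_SucD[OF Suc.prems]] show ?case .
qed simp

lemma Ck_on_compose_real:
  fixes f :: "'e::euclidean_space \<Rightarrow> real" and g :: "real \<Rightarrow> 'b::real_normed_vector"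
  assumes "open S"
  shows "Ck_on n f S \<Longrightarrow> Ck_on n g UNIV \<Longrightarrow> Ck_on n (\<lambda>x. g (f x)) S"
proof (induction n arbitrary: g)
  case 0
  then have "continuous_on UNIV g" "continuous_on S f" by simp_all
  then show ?case by (simp add: continuous_on_compose2)
next
  case (Suc n)
  have g: "(g has_derivative frechet_derivative g (at y)) (at y)" for y
    using Suc.prems(2) by (simp add: frechet_derivative_works)
  have g1: "frechet_derivative g (at y) r = r *\<^sub>R frechet_derivative g (at y) 1" for y r
    using linear_cmul[OF bounded_linear.linear[OF has_derivative_bounded_linear[OF g]], of y r 1] by simp
  show ?case
  proof (rule Ck_on_SucI[OF assms, where f' = "\<lambda>x v.
      frechet_derivative f (at x) v *\<^sub>R frechet_derivative g (at (f x)) 1"])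
    fix x assume "x \<in> S"
    then have "(f has_derivative frechet_derivative f (at x)) (at x)"
      using Suc.prems(1) by (simp add: frechet_derivative_works)
    from has_derivative_compose[OF this g]
    show "((\<lambda>x. g (f x)) has_derivative
        (\<lambda>v. frechet_derivative f (at x) v *\<^sub>R frechet_derivative g (at (f x)) 1)) (at x)"
      by (subst (asm) g1)
  next
    fix v
    have "Ck_on n (\<lambda>x. frechet_derivative f (at x) v) S" using Suc.prems(1) by simp
    moreover have "Ck_on n (\<lambda>y. frechet_derivative g (at y) 1) UNIV" using Suc.prems(2) by simp
    then have "Ck_on n (\<lambda>x. frechet_derivative g (at (f x)) 1) S"
      by (rule Suc.IH[OF Ck_on_SucD[OF Suc.prems(1)]])
    ultimately
    show "Ck_on n (\<lambda>x. frechet_derivative f (at x) v *\<^sub>R frechet_derivative g (at (f x)) 1) S"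
      by (rule Ck_on_bilinear[OF assms bounded_bilinear_scaleR])
  qed
qed

lemma Ck_on_cis: "Ck_on n cis UNIV"
proof (induction n)
  case 0
  then show ?case by (simp add: continuous_on_cis)
next
  case (Suc n)
  show ?case
  proof (rule Ck_on_SucI[where f' = "\<lambda>x v. v *\<^sub>R (\<i> * cis x)"])
    show "Ck_on n (\<lambda>x. v *\<^sub>R (\<i> * cis x)) UNIV" for v
      by (rule Ck_on_linear_comp[OF _ _ Suc])
        (auto intro: bounded_linear_compose[OF bounded_linear_scaleR_right bounded_linear_mult_right])
    show "(cis has_derivative (\<lambda>v. v *\<^sub>R (\<i> * cis x))) (at x)" for x
      by (rule has_derivative_eq_rhs[OF has_derivative_cis[OF has_derivative_ident]])
         (auto simp: fun_eq_iff)
  qed auto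
qed

lemma Ck_on_cos: "Ck_on n (cos :: real \<Rightarrow> real) UNIV"
  using Ck_on_linear_comp[OF open_UNIV bounded_linear_Re Ck_on_cis[of n]] by simp

lemma Ck_on_sin: "Ck_on n (sin :: real \<Rightarrow> real) UNIV"
  using Ck_on_linear_comp[OF open_UNIV bounded_linear_Im Ck_on_cis[of n]] by simp

lemma Ck_on_imp_has_derivative:
  "Ck_on (Suc n) f S \<Longrightarrow> x \<in> S \<Longrightarrow> (f has_derivative frechet_derivative f (at x)) (at x)"
  by (simp add: frechet_derivative_works)

lemma smooth_real_derivatives:
  fixes \<alpha> :: "real \<Rightarrow> real"
  assumes "smooth_on \<alpha> UNIV"
  obtains \<alpha>' \<alpha>'' where "\<And>s. (\<alpha> has_real_derivative \<alpha>' s) (at s)"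
    "\<And>s. (\<alpha>' has_real_derivative \<alpha>'' s) (at s)" "continuous_on UNIV \<alpha>''"
proof -
  have D: "(f has_real_derivative frechet_derivative f (at s) 1) (at s)" if "Ck_on (Suc n) f UNIV"
    for f :: "real \<Rightarrow> real" and n s
  proof -
    have f: "(f has_derivative frechet_derivative f (at s)) (at s)"
      using Ck_on_imp_has_derivative[OF that] by simp
    show ?thesis
    proof (rule has_derivative_imp_has_field_derivative[OF f])
      show "r * frechet_derivative f (at s) 1 = frechet_derivative f (at s) r" for r
        using linear_cmul[OF bounded_linear.linear[OF has_derivative_bounded_linear[OF f]], of r 1]
        by (metis mult_1_right real_scaleR_def)
    qed
  qed
  have 2: "Ck_on (Suc (Suc 0)) \<alpha> UNIV" using assms unfolding smooth_on_def by blast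
  then have 1: "Ck_on (Suc 0) (\<lambda>x. frechet_derivative \<alpha> (at x) 1) UNIV"
    unfolding Ck_on.simps(2)[of "Suc 0"] by blast
  show ?thesis
  proof (rule that)
    show "(\<alpha> has_real_derivative frechet_derivative \<alpha> (at s) 1) (at s)" for s
      by (rule D[OF 2])
    show "((\<lambda>s. frechet_derivative \<alpha> (at s) 1) has_real_derivative
        frechet_derivative (\<lambda>s. frechet_derivative \<alpha> (at s) 1) (at s) 1) (at s)" for s
      by (rule D[OF 1])
    show "continuous_on UNIV (\<lambda>s. frechet_derivative (\<lambda>s. frechet_derivative \<alpha> (at s) 1) (at s) 1)"
      using 1 by simp
  qed
qed

section \<open>Maps from flat quotients to the sphere\<close>

lemma orthonormal_basis_sum_squares:
  fixes B :: "'e::euclidean_space set"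
  assumes "orthonormal_basis inner B"
  shows "(\<Sum>e\<in>B. (e \<bullet> x)\<^sup>2) = x \<bullet> x"
proof -
  have B: "finite B" "card B = DIM('e)" "\<And>a b. a \<in> B \<Longrightarrow> b \<in> B \<Longrightarrow> a \<bullet> b = (if a = b then 1 else 0)"
    using assms by (auto simp: orthonormal_basis_def)
  have orth: "pairwise orthogonal B" by (auto simp: pairwise_def orthogonal_def B)
  have n1: "norm e = 1" if "e \<in> B" for e using B(3)[OF that that] by (simp add: norm_eq_sqrt_inner)
  have "independent B"
    by (rule pairwise_orthogonal_independent[OF orth]) (use n1 in force)
  then have "UNIV \<subseteq> span B"
    by (intro card_ge_dim_independent) (auto simp: B(2))
  then have "(\<Sum>e\<in>B. (x \<bullet> e) *\<^sub>R e) = x"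
    by (intro orthonormal_basis_expand[OF orth n1]) (use B in auto)
  then have "x \<bullet> x = x \<bullet> (\<Sum>e\<in>B. (x \<bullet> e) *\<^sub>R e)" by simp
  also have "\<dots> = (\<Sum>e\<in>B. (e \<bullet> x)\<^sup>2)"
    by (simp add: inner_sum_right power2_eq_square inner_commute)
  finally show ?thesis by simp
qed

text \<open>The squared Hilbert-Schmidt norm, which makes the energy density independent of the chosen
  basis; all sums equal the squared Hilbert-Schmidt norm of the adjoint.\<close>

lemma sum_norm_orthonormal_basis:
  fixes L :: "'e::euclidean_space \<Rightarrow> 'f::euclidean_space"
  assumes "orthonormal_basis inner B" "linear L"
  shows "(\<Sum>e\<in>B. L e \<bullet> L e) = (\<Sum>i\<in>Basis. L i \<bullet> L i)"
proof -
  have *: "(\<Sum>e\<in>C. L e \<bullet> L e) = (\<Sum>j\<in>Basis. adjoint L j \<bullet> adjoint L j)"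
    if "orthonormal_basis inner C" for C
  proof -
    have "(\<Sum>e\<in>C. L e \<bullet> L e) = (\<Sum>e\<in>C. \<Sum>j\<in>Basis. (e \<bullet> adjoint L j)\<^sup>2)"
      by (subst euclidean_inner) (simp add: power2_eq_square adjoint_works[OF assms(2)])
    also have "\<dots> = (\<Sum>j\<in>Basis. \<Sum>e\<in>C. (e \<bullet> adjoint L j)\<^sup>2)" by (rule sum.swap)
    finally show ?thesis by (simp add: orthonormal_basis_sum_squares[OF that])
  qed
  have "orthonormal_basis inner (Basis :: 'e set)" by (simp add: orthonormal_basis_def inner_Basis)
  with *[OF this] *[OF assms(1)] show ?thesis by simp
qed

text \<open>The chart of the sphere centred at the pole opposite to \<open>(\<sigma>, 0)\<close>, for \<open>\<sigma> = \<plusminus>1\<close>.\<close>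

abbreviation sphere_chart :: "real \<Rightarrow> complex set \<times> (complex \<Rightarrow> real \<times> complex)" where
  "sphere_chart \<sigma> \<equiv> (UNIV, inv_stereographic \<sigma>)"

lemma params_sphere:
  assumes "d \<in> params unit_sphere"
  obtains \<sigma> where "\<sigma>\<^sup>2 = 1" "d = (sphere_chart \<sigma>)"
  using assms that[of 1] that[of "-1"] by (auto simp: unit_sphere_def)

text \<open>A map \<open>\<psi>\<close> from the quotient \<open>range p\<close> of a Euclidean space to the unit sphere, described
  by its lift \<open>F = \<psi> \<circ> p\<close> to the Euclidean space.\<close>

locale sphere_lift =
  fixes p :: "'e::euclidean_space \<Rightarrow> 'a" and \<psi> :: "'a \<Rightarrow> real \<times> complex"
    and F :: "'e \<Rightarrow> real \<times> complex"
  assumes lift: "\<psi> (p u) = F u"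
    and on_sphere: "F u \<in> sphere 0 1"
begin

lemma loc_dom_eq:
  assumes "\<sigma>\<^sup>2 = 1"
  shows "loc_dom (U, p) (sphere_chart \<sigma>) \<psi> = U \<inter> F -` (- {(\<sigma>, 0)})"
  using on_sphere by (auto simp: loc_dom_def lift range_inv_stereographic[OF assms])

lemma inv_stereographic_loc:
  assumes "\<sigma>\<^sup>2 = 1" "u \<in> loc_dom (U, p) (sphere_chart \<sigma>) \<psi>"
  shows "inv_stereographic \<sigma> (loc (U, p) (sphere_chart \<sigma>) \<psi> u) = F u"
  using assms by (simp add: loc_dom_def loc_def lift f_the_inv_into_f inj_inv_stereographic)

lemma loc_eq:
  assumes "\<sigma>\<^sup>2 = 1" "u \<in> loc_dom (U, p) (sphere_chart \<sigma>) \<psi>"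
  shows "loc (U, p) (sphere_chart \<sigma>) \<psi> u = stereographic \<sigma> (F u)"
  using inv_stereographic_loc[OF assms] stereographic_inverse[OF assms(1)] by metis

lemma Ck_on_stereographic:
  assumes "\<sigma>\<^sup>2 = 1" "open S" "Ck_on n F S" "\<And>u. u \<in> S \<Longrightarrow> F u \<noteq> (\<sigma>, 0)"
  shows "Ck_on n (\<lambda>u. stereographic \<sigma> (F u)) S"
proof -
  have ne: "1 + (- \<sigma>) * fst (F u) \<noteq> 0" if "u \<in> S" for u
  proof -
    have "F u \<in> range (inv_stereographic \<sigma>)"
      unfolding range_inv_stereographic[OF assms(1)] using on_sphere assms(4)[OF that] by blast
    then obtain z where "F u = inv_stereographic \<sigma> z" by blast
    then show ?thesis
      using stereographic_denom[OF assms(1), of z] norm_sq_plus_1[of z] by simp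
  qed
  have "Ck_on n (\<lambda>u. inverse (1 + (- \<sigma>) * fst (F u)) *\<^sub>R snd (F u)) S"
    by (intro Ck_on_bilinear[OF assms(2) bounded_bilinear_scaleR] Ck_on_inverse assms(2) ne
        Ck_on_add Ck_on_const Ck_on_linear_comp[OF assms(2) _ assms(3)]
        Ck_on_bilinear[OF assms(2) bounded_bilinear_mult] bounded_linear_fst bounded_linear_snd)
  then show ?thesis by (simp add: stereographic_def inverse_eq_divide)
qed

lemma open_loc_dom:
  assumes "\<sigma>\<^sup>2 = 1" "open U" "continuous_on UNIV F"
  shows "open (loc_dom (U, p) (sphere_chart \<sigma>) \<psi>)"
  unfolding loc_dom_eq[OF assms(1)]
  by (intro open_Int assms(2) open_vimage[OF _ assms(3)]) auto

lemma Ck_on_loc: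
  assumes "\<sigma>\<^sup>2 = 1" "open U" "Ck_on n F UNIV"
  shows "Ck_on n (loc (U, p) (sphere_chart \<sigma>) \<psi>)
    (loc_dom (U, p) (sphere_chart \<sigma>) \<psi>)"
proof -
  let ?S = "loc_dom (U, p) (sphere_chart \<sigma>) \<psi>"
  have cont: "continuous_on UNIV F"
    by (rule Ck_on_imp_continuous_on[OF assms(3)])
  have op: "open ?S" by (rule open_loc_dom[OF assms(1,2) cont])
  have "Ck_on n (\<lambda>u. stereographic \<sigma> (F u)) ?S"
    by (rule Ck_on_stereographic[OF assms(1) op Ck_on_subset[OF assms(3) subset_UNIV]])
      (auto simp: loc_dom_eq[OF assms(1)])
  then show ?thesis
    by (rule Ck_on_cong[OF op, rotated]) (rule loc_eq[OF assms(1), symmetric])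
qed

lemma Ck_map:
  assumes "Ck_on n F UNIV"
  shows "Ck_map n (flat_quotient p) unit_sphere \<psi>"
proof -
  have cont: "continuous_on UNIV F"
    by (rule Ck_on_imp_continuous_on[OF assms])
  have "\<psi> ` range p \<subseteq> sphere 0 1" using lift on_sphere by auto
  then show ?thesis
    unfolding Ck_map_def
    by (fastforce simp: flat_quotient_def unit_sphere_def simp del: Ck_on.simps
        intro: open_loc_dom[OF _ _ cont] Ck_on_loc[OF _ _ assms])
qed

text \<open>The map is differentiated through its lift: the inverse of the stereographic projection turns
  derivatives in a chart into derivatives of \<open>F\<close> in the ambient space.\<close>

lemma derivative_loc:
  assumes "\<sigma>\<^sup>2 = 1" "open U" "Ck_on 1 F UNIV" "(F has_derivative F') (at u)"
    and u: "u \<in> loc_dom (U, p) (sphere_chart \<sigma>) \<psi>"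
  shows "frechet_derivative (inv_stereographic \<sigma>) (at (loc (U, p) (sphere_chart \<sigma>) \<psi> u)) (dloc (U, p) (sphere_chart \<sigma>) \<psi> u v) = F' v"
proof -
  have "(loc (U, p) (sphere_chart \<sigma>) \<psi> has_derivative dloc (U, p) (sphere_chart \<sigma>) \<psi> u) (at u)"
    unfolding dloc_def using Ck_on_imp_has_derivative[of 0] Ck_on_loc[OF assms(1-3)] u by simp
  from has_derivative_compose[OF this inv_stereographic_has_derivative[of \<sigma>]]
  have "(F has_derivative (\<lambda>v. frechet_derivative (inv_stereographic \<sigma>) (at (loc (U, p) (sphere_chart \<sigma>) \<psi> u))
      (dloc (U, p) (sphere_chart \<sigma>) \<psi> u v))) (at u)"
    by (rule has_derivative_transform_within_open[OF _
          open_loc_dom[OF assms(1,2) Ck_on_imp_continuous_on[OF assms(3)]] u])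
      (rule inv_stereographic_loc[OF assms(1)])
  from has_derivative_unique[OF this assms(4)] show ?thesis by metis
qed

lemma pullback_form_eq:
  assumes "\<sigma>\<^sup>2 = 1" "open U" "Ck_on 1 F UNIV" "(F has_derivative F') (at u)"
    and u: "u \<in> loc_dom (U, p) (sphere_chart \<sigma>) \<psi>"
  shows "pullback_form unit_sphere (U, p) (sphere_chart \<sigma>) \<psi> u v w = F' v \<bullet> F' w"
  using derivative_loc[OF assms] by (simp add: pullback_form_def unit_sphere_def)

lemma dloc_eq_0_iff:
  assumes "\<sigma>\<^sup>2 = 1" "open U" "Ck_on 1 F UNIV" "(F has_derivative F') (at u)"
    and u: "u \<in> loc_dom (U, p) (sphere_chart \<sigma>) \<psi>"
  shows "dloc (U, p) (sphere_chart \<sigma>) \<psi> u v = 0 \<longleftrightarrow> F' v = 0"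
proof -
  have "linear (frechet_derivative (inv_stereographic \<sigma>) (at (loc (U, p) (sphere_chart \<sigma>) \<psi> u)))"
    using inv_stereographic_has_derivative has_derivative_bounded_linear bounded_linear.linear by blast
  then show ?thesis
    using derivative_loc[OF assms, of v] inj_derivative_inv_stereographic[OF assms(1)] linear_0 by metis
qed

lemma energy_density_eq:
  assumes "\<sigma>\<^sup>2 = 1" "open U" "Ck_on 1 F UNIV" "(F has_derivative F') (at u)"
    and u: "u \<in> loc_dom (U, p) (sphere_chart \<sigma>) \<psi>"
  shows "energy_density (flat_quotient p) unit_sphere (U, p) (sphere_chart \<sigma>) \<psi> u =
    (\<Sum>i\<in>Basis. F' i \<bullet> F' i)"
proof -
  let ?B = "SOME B. orthonormal_basis (inner :: 'e \<Rightarrow> 'e \<Rightarrow> real) B"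
  have "orthonormal_basis (inner :: 'e \<Rightarrow> 'e \<Rightarrow> real) ?B"
    by (rule someI[of _ Basis]) (simp add: orthonormal_basis_def inner_Basis)
  moreover have "linear F'"
    using assms(4) has_derivative_bounded_linear bounded_linear.linear by blast
  ultimately have "(\<Sum>e\<in>?B. F' e \<bullet> F' e) = (\<Sum>i\<in>Basis. F' i \<bullet> F' i)"
    by (rule sum_norm_orthonormal_basis)
  then show ?thesis
    by (simp add: energy_density_def pullback_form_eq[OF assms] flat_quotient_def)
qed

text \<open>The condition of being infinity-harmonic at a point, in terms of the lift; \<open>G\<close> is the gradient of
  the energy density \<open>\<Sum>\<^sub>i \<bar>F' i\<bar>\<^sup>2\<close>.\<close>

lemma infinity_laplacian_eq_0_iff:
  assumes "\<sigma>\<^sup>2 = 1" "open U" "Ck_on 1 F UNIV"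
    and F': "\<And>u. (F has_derivative F' u) (at u)"
    and G: "((\<lambda>u. \<Sum>i\<in>Basis. F' u i \<bullet> F' u i) has_derivative (\<lambda>w. G \<bullet> w)) (at u)"
    and u: "u \<in> loc_dom (U, p) (sphere_chart \<sigma>) \<psi>"
  shows "(1/2) *\<^sub>R dloc (U, p) (sphere_chart \<sigma>) \<psi> u (grad (flat_quotient p) (U, p)
    (energy_density (flat_quotient p) unit_sphere (U, p) (sphere_chart \<sigma>) \<psi>) u) = 0 \<longleftrightarrow> F' u G = 0"
proof -
  let ?E = "energy_density (flat_quotient p) unit_sphere (U, p) (sphere_chart \<sigma>) \<psi>"
  have "(?E has_derivative (\<lambda>w. G \<bullet> w)) (at u)"
    by (rule has_derivative_transform_within_open[OF G
          open_loc_dom[OF assms(1,2) Ck_on_imp_continuous_on[OF assms(3)]] u])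
      (rule energy_density_eq[OF assms(1-3) F', symmetric])
  from frechet_derivative_at[OF this] have D: "frechet_derivative ?E (at u) = (\<lambda>w. G \<bullet> w)"
    by (rule sym)
  have "grad (flat_quotient p) (U, p) ?E u = (THE v. \<forall>w. v \<bullet> w = G \<bullet> w)"
    unfolding grad_def D by (simp add: flat_quotient_def)
  also have "\<dots> = G"
    by (rule the_equality) (auto simp: vector_eq_rdot)
  finally show ?thesis
    using dloc_eq_0_iff[OF assms(1-3) F' u] by simp
qed

lemma infinity_harmonicI:
  assumes "Ck_on 2 F UNIV"
    and F': "\<And>u. (F has_derivative F' u) (at u)"
    and G: "\<And>u. ((\<lambda>u. \<Sum>i\<in>Basis. F' u i \<bullet> F' u i) has_derivative (\<lambda>w. G u \<bullet> w)) (at u)"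
    and "\<And>u. F' u (G u) = 0"
  shows "infinity_harmonic (flat_quotient p) unit_sphere \<psi>"
  unfolding infinity_harmonic_def
proof (intro conjI ballI)
  have 1: "Ck_on 1 F UNIV" using assms(1) Ck_on_SucD[of 1 F UNIV] by (simp add: numeral_2_eq_2)
  show "Ck_map 2 (flat_quotient p) unit_sphere \<psi>" by (rule Ck_map[OF assms(1)])
  fix c d u assume c: "c \<in> params (flat_quotient p)" and "d \<in> params unit_sphere"
    and u: "u \<in> loc_dom c d \<psi>"
  then obtain \<sigma> where d: "\<sigma>\<^sup>2 = 1" "d = sphere_chart \<sigma>" by (elim params_sphere)
  from c obtain U where U: "c = (U, p)" "open U" by (auto simp: flat_quotient_def)
  show "(1/2) *\<^sub>R dloc c d \<psi> u (grad (flat_quotient p) c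
      (energy_density (flat_quotient p) unit_sphere c d \<psi>) u) = 0"
    using infinity_laplacian_eq_0_iff[OF d(1) U(2) 1 F' G u[unfolded U d]] assms(4) unfolding U d by blast
qed

lemma infinity_harmonicD:
  assumes "infinity_harmonic (flat_quotient p) unit_sphere \<psi>"
    and "Ck_on 1 F UNIV"
    and F': "\<And>u. (F has_derivative F' u) (at u)"
    and G: "((\<lambda>u. \<Sum>i\<in>Basis. F' u i \<bullet> F' u i) has_derivative (\<lambda>w. G \<bullet> w)) (at u)"
    and U: "open U" "inj_on p U" "u \<in> U"
  shows "F' u G = 0"
proof -
  \<comment> \<open>A projection centre different from the image point.\<close>
  define \<sigma> :: real where "\<sigma> = (if F u = (1, 0) then -1 else 1)"
  then have \<sigma>: "\<sigma> = 1 \<or> \<sigma> = -1" "F u \<noteq> (\<sigma>, 0)" by auto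
  then have \<sigma>2: "\<sigma>\<^sup>2 = 1" by auto
  have u: "u \<in> loc_dom (U, p) (sphere_chart \<sigma>) \<psi>"
    using U(3) \<sigma>(2) by (simp add: loc_dom_eq[OF \<sigma>2])
  have "(U, p) \<in> params (flat_quotient p)" "sphere_chart \<sigma> \<in> params unit_sphere"
    using U \<sigma>(1) by (auto simp: flat_quotient_def unit_sphere_def)
  then show ?thesis
    using assms(1) u infinity_laplacian_eq_0_iff[OF \<sigma>2 U(1) assms(2) F' G u]
    unfolding infinity_harmonic_def by blast
qed

end

section \<open>Rotationally symmetric maps\<close>

text \<open>The lift to the plane of the rotationally symmetric map with profile \<open>\<alpha>\<close> and rotation speed
  \<open>\<kappa>\<close>. The speed may be any real number, because the plane, unlike the cylinder, imposes no
  periodicity in \<open>t\<close>.\<close>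

definition rot_lift :: "real \<Rightarrow> (real \<Rightarrow> real) \<Rightarrow> real \<times> real \<Rightarrow> real \<times> complex" where
  "rot_lift \<kappa> \<alpha> = (\<lambda>(s, t). (cos (\<alpha> s), sin (\<alpha> s) *\<^sub>R cis (\<kappa> * t)))"

lemma rot_lift_on_sphere: "rot_lift \<kappa> \<alpha> u \<in> sphere 0 1"
  by (cases u) (simp add: rot_lift_def norm_Pair power_mult_distrib)

lemma Ck_on_rot_lift:
  assumes "smooth_on \<alpha> UNIV"
  shows "Ck_on n (rot_lift \<kappa> \<alpha>) UNIV"
proof -
  have fst: "Ck_on n fst (UNIV :: (real \<times> real) set)"
    and snd: "Ck_on n snd (UNIV :: (real \<times> real) set)"
    by (rule Ck_on_linear[OF open_UNIV bounded_linear_fst] Ck_on_linear[OF open_UNIV bounded_linear_snd])+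
  have "Ck_on n \<alpha> UNIV" using assms by (simp add: smooth_on_def)
  from Ck_on_compose_real[OF open_UNIV fst this]
  have \<alpha>: "Ck_on n (\<lambda>u. \<alpha> (fst u)) (UNIV :: (real \<times> real) set)" .
  have t: "Ck_on n (\<lambda>u. \<kappa> * snd u) (UNIV :: (real \<times> real) set)"
    by (rule Ck_on_linear_comp[OF open_UNIV bounded_linear_mult_right snd])
  have "Ck_on n (\<lambda>u. (cos (\<alpha> (fst u)), sin (\<alpha> (fst u)) *\<^sub>R cis (\<kappa> * snd u)))
      (UNIV :: (real \<times> real) set)"
    by (rule Ck_on_Pair[OF open_UNIV Ck_on_compose_real[OF open_UNIV \<alpha> Ck_on_cos]
        Ck_on_bilinear[OF open_UNIV bounded_bilinear_scaleR
          Ck_on_compose_real[OF open_UNIV \<alpha> Ck_on_sin] Ck_on_compose_real[OF open_UNIV t Ck_on_cis]]])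
  then show ?thesis by (simp add: rot_lift_def case_prod_unfold)
qed

text \<open>Its derivative at \<open>(s, t)\<close>, when \<open>\<alpha>'\<close> is the derivative of \<open>\<alpha>\<close>.\<close>

definition rot_lift_deriv :: "real \<Rightarrow> (real \<Rightarrow> real) \<Rightarrow> (real \<Rightarrow> real) \<Rightarrow>
    real \<times> real \<Rightarrow> real \<times> real \<Rightarrow> real \<times> complex" where
  "rot_lift_deriv \<kappa> \<alpha> \<alpha>' = (\<lambda>(s, t) (a, b). (- (sin (\<alpha> s) * \<alpha>' s * a),
     (cos (\<alpha> s) * \<alpha>' s * a) *\<^sub>R cis (\<kappa> * t) + (\<kappa> * sin (\<alpha> s) * b) *\<^sub>R (\<i> * cis (\<kappa> * t))))"

lemma rot_lift_has_derivative:
  assumes "\<And>s. (\<alpha> has_real_derivative \<alpha>' s) (at s)"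
  shows "(rot_lift \<kappa> \<alpha> has_derivative rot_lift_deriv \<kappa> \<alpha> \<alpha>' u) (at u)"
proof -
  have \<alpha>: "((\<lambda>u. \<alpha> (fst u)) has_derivative (\<lambda>v. \<alpha>' (fst u) * fst v)) (at u)"
    by (rule has_derivative_compose[OF has_derivative_fst[OF has_derivative_ident]
          assms[unfolded has_field_derivative_def]])
  have t: "((\<lambda>u. \<kappa> * snd u) has_derivative (\<lambda>v. \<kappa> * snd v)) (at u)"
    by (rule has_derivative_mult_right[OF has_derivative_snd[OF has_derivative_ident]])
  have "((\<lambda>u. (cos (\<alpha> (fst u)), sin (\<alpha> (fst u)) *\<^sub>R cis (\<kappa> * snd u))) has_derivative
      (\<lambda>v. (\<alpha>' (fst u) * fst v * - sin (\<alpha> (fst u)),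
        sin (\<alpha> (fst u)) *\<^sub>R ((\<kappa> * snd v) *\<^sub>R (\<i> * cis (\<kappa> * snd u))) +
        (\<alpha>' (fst u) * fst v * cos (\<alpha> (fst u))) *\<^sub>R cis (\<kappa> * snd u)))) (at u)"
    by (rule has_derivative_Pair[OF has_derivative_cos[OF \<alpha>]
        has_derivative_scaleR[OF has_derivative_sin[OF \<alpha>] has_derivative_cis[OF t]]])
  then show ?thesis
    unfolding rot_lift_def rot_lift_deriv_def case_prod_unfold
    by (rule has_derivative_eq_rhs) (simp add: fun_eq_iff mult_ac add.commute)
qed

lemma rot_lift_energy:
  "(\<Sum>i\<in>Basis. rot_lift_deriv \<kappa> \<alpha> \<alpha>' u i \<bullet> rot_lift_deriv \<kappa> \<alpha> \<alpha>' u i) =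
    (\<alpha>' (fst u))\<^sup>2 + \<kappa>\<^sup>2 * (sin (\<alpha> (fst u)))\<^sup>2"
proof (cases u)
  case (Pair s t)
  have 1: "cis (\<kappa> * t) \<bullet> cis (\<kappa> * t) = 1"
    and 2: "(\<i> * cis (\<kappa> * t)) \<bullet> (\<i> * cis (\<kappa> * t)) = 1"
    by (simp_all flip: power2_norm_eq_inner add: norm_mult)
  have B: "(Basis :: (real \<times> real) set) = {(1, 0), (0, 1)}" by (auto simp: Basis_prod_def)
  have "(\<Sum>i\<in>Basis. rot_lift_deriv \<kappa> \<alpha> \<alpha>' u i \<bullet> rot_lift_deriv \<kappa> \<alpha> \<alpha>' u i) =
      (sin (\<alpha> s) * \<alpha>' s)\<^sup>2 + (cos (\<alpha> s) * \<alpha>' s)\<^sup>2 + \<kappa>\<^sup>2 * (sin (\<alpha> s))\<^sup>2"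
    by (simp add: Pair B rot_lift_deriv_def 1 2) (simp add: power2_eq_square algebra_simps)
  also have "(sin (\<alpha> s) * \<alpha>' s)\<^sup>2 + (cos (\<alpha> s) * \<alpha>' s)\<^sup>2 = (\<alpha>' s)\<^sup>2"
    by (simp add: power_mult_distrib flip: distrib_right)
  finally show ?thesis by (simp add: Pair)
qed

text \<open>A smooth profile \<open>\<alpha>\<close> together with its first two derivatives.\<close>

locale rotational =
  fixes \<kappa> :: real and \<alpha> \<alpha>' \<alpha>'' :: "real \<Rightarrow> real"
  assumes smooth: "smooth_on \<alpha> UNIV"
    and deriv1: "(\<alpha> has_real_derivative \<alpha>' s) (at s)"
    and deriv2: "(\<alpha>' has_real_derivative \<alpha>'' s) (at s)"
    and cont2: "continuous_on UNIV \<alpha>''"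
begin

text \<open>The defect of \<open>2\<alpha>\<close> in the pendulum equation.\<close>

definition pend :: "real \<Rightarrow> real" where
  "pend s = 2 * \<alpha>'' s + \<kappa>\<^sup>2 * sin (2 * \<alpha> s)"

lemma energy_has_derivative:
  "((\<lambda>s. (\<alpha>' s)\<^sup>2 + \<kappa>\<^sup>2 * (sin (\<alpha> s))\<^sup>2) has_real_derivative \<alpha>' s * pend s) (at s)"
  by (rule derivative_eq_intros deriv1 deriv2 refl)+
    (simp add: pend_def sin_double, simp add: power2_eq_square algebra_simps)

lemma energy_gradient:
  "((\<lambda>u. \<Sum>i\<in>Basis. rot_lift_deriv \<kappa> \<alpha> \<alpha>' u i \<bullet> rot_lift_deriv \<kappa> \<alpha> \<alpha>' u i)
    has_derivative (\<lambda>w. (\<alpha>' (fst u) * pend (fst u), 0) \<bullet> w)) (at u)"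
proof -
  have "((\<lambda>u. (\<alpha>' (fst u))\<^sup>2 + \<kappa>\<^sup>2 * (sin (\<alpha> (fst u)))\<^sup>2) has_derivative
      (\<lambda>w. \<alpha>' (fst u) * pend (fst u) * fst w)) (at u)"
    by (rule has_derivative_compose[OF has_derivative_fst[OF has_derivative_ident]
          energy_has_derivative[unfolded has_field_derivative_def]])
  moreover have "(\<lambda>w. \<alpha>' (fst u) * pend (fst u) * fst w) =
      (\<lambda>w. (\<alpha>' (fst u) * pend (fst u), 0 :: real) \<bullet> w)"
    by (auto simp: fun_eq_iff inner_prod_def)
  ultimately show ?thesis unfolding rot_lift_energy by simp
qed

lemma rot_lift_deriv_gradient_eq_0_iff:
  "rot_lift_deriv \<kappa> \<alpha> \<alpha>' u (\<alpha>' (fst u) * pend (fst u), 0) = 0 \<longleftrightarrow> \<alpha>' (fst u) * pend (fst u) = 0"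
proof -
  obtain s t where u: "u = (s, t)" by (cases u)
  have "sin (\<alpha> s) \<noteq> 0 \<or> cos (\<alpha> s) \<noteq> 0"
    using sin_zero_abs_cos_one by fastforce
  then show ?thesis by (auto simp: u rot_lift_deriv_def zero_prod_def)
qed

lemma infinity_harmonic_rotI:
  fixes p :: "real \<times> real \<Rightarrow> 'a"
  assumes "\<And>u. \<psi> (p u) = rot_lift \<kappa> \<alpha> u" "\<And>s. \<alpha>' s * pend s = 0"
  shows "infinity_harmonic (flat_quotient p) unit_sphere \<psi>"
proof -
  interpret sphere_lift p \<psi> "rot_lift \<kappa> \<alpha>"
    by unfold_locales (rule assms(1) rot_lift_on_sphere)+
  show ?thesis
    by (rule infinity_harmonicI[OF Ck_on_rot_lift[OF smooth] rot_lift_has_derivative[OF deriv1]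
          energy_gradient]) (rule rot_lift_deriv_gradient_eq_0_iff[THEN iffD2, OF assms(2)])
qed

lemma infinity_harmonic_rotD:
  fixes p :: "real \<times> real \<Rightarrow> 'a"
  assumes "\<And>u. \<psi> (p u) = rot_lift \<kappa> \<alpha> u"
    and "infinity_harmonic (flat_quotient p) unit_sphere \<psi>"
    and "open U" "inj_on p U" "(s, t) \<in> U"
  shows "\<alpha>' s * pend s = 0"
proof -
  interpret sphere_lift p \<psi> "rot_lift \<kappa> \<alpha>"
    by unfold_locales (rule assms(1) rot_lift_on_sphere)+
  from infinity_harmonicD[OF assms(2) Ck_on_rot_lift[OF smooth] rot_lift_has_derivative[OF deriv1]
      energy_gradient assms(3-5)]
  show ?thesis unfolding rot_lift_deriv_gradient_eq_0_iff by simp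
qed

end

section \<open>The pendulum equation\<close>

text \<open>Gronwall's uniqueness argument: \<open>y\<^sup>2 e\<^bsup>-2Cs\<^esup>\<close> decreases to the right of a zero and
  \<open>y\<^sup>2 e\<^bsup>2Cs\<^esup>\<close> increases to the left of it.\<close>

lemma linear_growth_imp_zero:
  fixes y :: "real \<Rightarrow> real"
  assumes y: "\<And>s. (y has_real_derivative y' s) (at s)"
    and le: "\<And>s. \<bar>y' s\<bar> \<le> C * \<bar>y s\<bar>" and "y s0 = 0"
  shows "y s = 0"
proof -
  have bound: "\<bar>2 * (y x * y' x)\<bar> \<le> 2 * C * (y x)\<^sup>2" for x
  proof -
    have "\<bar>y x\<bar> * \<bar>y' x\<bar> \<le> \<bar>y x\<bar> * (C * \<bar>y x\<bar>)" by (rule mult_left_mono[OF le]) simp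
    also have "\<dots> = C * (y x)\<^sup>2" by (simp add: power2_eq_square)
    finally show ?thesis by (simp add: abs_mult)
  qed
  have D: "((\<lambda>x. (y x)\<^sup>2 * exp (c * x)) has_real_derivative
      (2 * (y x * y' x) + c * (y x)\<^sup>2) * exp (c * x)) (at x)" for c x
    by (rule derivative_eq_intros y refl)+ (simp add: algebra_simps)
  have "(y s)\<^sup>2 * exp (c * s) \<le> 0" if "c = (if s0 \<le> s then - (2 * C) else 2 * C)" for c
  proof (cases "s0 \<le> s")
    case True
    have le0: "(2 * (y x * y' x) + c * (y x)\<^sup>2) * exp (c * x) \<le> 0" for x
    proof (rule mult_nonpos_nonneg)
      have "c * (y x)\<^sup>2 = - (2 * C * (y x)\<^sup>2)" using True that by simp
      then show "2 * (y x * y' x) + c * (y x)\<^sup>2 \<le> 0" using bound[of x] by linarith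
    qed simp
    have "(y s)\<^sup>2 * exp (c * s) \<le> (y s0)\<^sup>2 * exp (c * s0)"
      by (rule DERIV_nonpos_imp_nonincreasing[OF True]) (rule exI, rule conjI, rule D, rule le0)
    then show ?thesis using assms(3) by simp
  next
    case False
    have ge0: "0 \<le> (2 * (y x * y' x) + c * (y x)\<^sup>2) * exp (c * x)" for x
    proof (rule mult_nonneg_nonneg)
      have "c * (y x)\<^sup>2 = 2 * C * (y x)\<^sup>2" using False that by simp
      then show "0 \<le> 2 * (y x * y' x) + c * (y x)\<^sup>2" using bound[of x] by linarith
    qed simp
    have "s \<le> s0" using False by simp
    then have "(y s)\<^sup>2 * exp (c * s) \<le> (y s0)\<^sup>2 * exp (c * s0)"
      by (rule DERIV_nonneg_imp_nondecreasing) (rule exI, rule conjI, rule D, rule ge0)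
    then show ?thesis using assms(3) by simp
  qed
  from this[OF refl] have "(y s)\<^sup>2 \<le> 0" by (simp add: mult_le_0_iff)
  then show ?thesis by simp
qed

context rotational
begin

lemma pendulum_solution_iff:
  "pendulum_solution \<kappa> (\<lambda>s. 2 * \<alpha> s) \<longleftrightarrow> (\<forall>s. pend s = 0)"
proof
  assume "pendulum_solution \<kappa> (\<lambda>s. 2 * \<alpha> s)"
  then obtain \<theta>' \<theta>'' where \<theta>: "\<And>s. ((\<lambda>s. 2 * \<alpha> s) has_real_derivative \<theta>' s) (at s)"
    "\<And>s. (\<theta>' has_real_derivative \<theta>'' s) (at s)" "\<And>s. \<theta>'' s + \<kappa>\<^sup>2 * sin (2 * \<alpha> s) = 0"
    unfolding pendulum_solution_def by blast
  have "\<theta>' = (\<lambda>s. 2 * \<alpha>' s)"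
    using DERIV_unique[OF \<theta>(1) DERIV_cmult[OF deriv1, of 2]] by blast
  with \<theta>(2) have "((\<lambda>s. 2 * \<alpha>' s) has_real_derivative \<theta>'' s) (at s)" for s by simp
  then have "\<theta>'' s = 2 * \<alpha>'' s" for s
    using DERIV_unique[OF _ DERIV_cmult[OF deriv2, of 2]] by blast
  with \<theta>(3) show "\<forall>s. pend s = 0" by (simp add: pend_def)
next
  assume "\<forall>s. pend s = 0"
  then show "pendulum_solution \<kappa> (\<lambda>s. 2 * \<alpha> s)"
    unfolding pendulum_solution_def pend_def
    by (intro exI[of _ "\<lambda>s. 2 * \<alpha>' s"] exI[of _ "\<lambda>s. 2 * \<alpha>'' s"])
      (auto intro: DERIV_cmult deriv1 deriv2)
qed

text \<open>Uniqueness of the equilibrium solutions, from conservation of energy.\<close>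

lemma constant_if_equilibrium:
  assumes "\<And>s. \<alpha>' s * pend s = 0" "\<alpha>' s0 = 0" "sin (2 * \<alpha> s0) = 0"
  shows "\<alpha>' s = 0"
proof -
  have E: "(\<alpha>' s)\<^sup>2 + \<kappa>\<^sup>2 * (sin (\<alpha> s))\<^sup>2 = \<kappa>\<^sup>2 * (sin (\<alpha> s0))\<^sup>2" for s
    using DERIV_isconst_all[of "\<lambda>s. (\<alpha>' s)\<^sup>2 + \<kappa>\<^sup>2 * (sin (\<alpha> s))\<^sup>2" s s0]
      energy_has_derivative assms(1,2) by simp
  show ?thesis
  proof (cases "sin (\<alpha> s0) = 0")
    case True
    then have "(\<alpha>' s)\<^sup>2 + \<kappa>\<^sup>2 * (sin (\<alpha> s))\<^sup>2 = 0" using E[of s] by simp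
    then show ?thesis by (simp add: sum_power2_eq_zero_iff flip: power_mult_distrib)
  next
    case False
    then have "cos (\<alpha> s0) = 0" using assms(3) by (simp add: sin_double)
    then have "(sin (\<alpha> s0))\<^sup>2 = 1" by (simp add: sin_squared_eq)
    then have "(\<alpha>' s)\<^sup>2 = (\<kappa> * cos (\<alpha> s))\<^sup>2" for s
      using E[of s] by (simp add: cos_squared_eq power_mult_distrib algebra_simps)
    then have abs: "\<bar>\<alpha>' s\<bar> = \<bar>\<kappa>\<bar> * \<bar>cos (\<alpha> s)\<bar>" for s
      by (metis abs_mult power2_eq_iff abs_minus)
    have "((\<lambda>s. cos (\<alpha> s)) has_real_derivative - sin (\<alpha> s) * \<alpha>' s) (at s)" for s
      by (rule derivative_eq_intros deriv1 refl)+
    moreover have "\<bar>- sin (\<alpha> s) * \<alpha>' s\<bar> \<le> \<bar>\<kappa>\<bar> * \<bar>cos (\<alpha> s)\<bar>" for s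
      using mult_right_mono[OF abs_sin_le_one, of "\<bar>\<alpha>' s\<bar>" "\<alpha> s"] by (simp add: abs_mult abs)
    ultimately have "cos (\<alpha> s) = 0"
      using \<open>cos (\<alpha> s0) = 0\<close>
      by (rule linear_growth_imp_zero[where y = "\<lambda>s. cos (\<alpha> s)"])
    then show ?thesis using abs[of s] by simp
  qed
qed

lemma constant_or_pendulum:
  assumes "\<kappa> \<noteq> 0" and harm: "\<And>s. \<alpha>' s * pend s = 0"
  shows "(\<exists>a. \<forall>s. \<alpha> s = a) \<or> (\<forall>s. pend s = 0)"
proof (rule ccontr)
  assume neg: "\<not> ?thesis"
  have nc: "\<not> (\<forall>s. \<alpha>' s = 0)"
  proof
    assume "\<forall>s. \<alpha>' s = 0"
    then have "(\<alpha> has_real_derivative 0) (at s)" for s using deriv1[of s] by simp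
    then have "\<alpha> s = \<alpha> 0" for s using DERIV_isconst_all[of \<alpha> s 0] by blast
    then show False using neg by blast
  qed
  \<comment> \<open>The set \<open>N\<close> is open by continuity of \<open>pend\<close>; the description by \<open>\<alpha>' = \<alpha>'' = 0\<close> shows that it
    is closed as well.\<close>
  define N where "N = {s. pend s \<noteq> 0}"
  have c0: "continuous_on UNIV \<alpha>"
    by (rule continuous_at_imp_continuous_on) (use DERIV_isCont[OF deriv1] in blast)
  have c1: "continuous_on UNIV \<alpha>'"
    by (rule continuous_at_imp_continuous_on) (use DERIV_isCont[OF deriv2] in blast)
  have "continuous_on UNIV pend"
    unfolding pend_def by (intro continuous_intros cont2 c0)
  then have "open (pend -` (- {0}))" by (intro open_vimage) auto
  then have "open N" by (simp add: N_def vimage_def)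
  have "N = {s. \<alpha>' s = 0} \<inter> {s. \<alpha>'' s = 0}"
  proof (intro equalityI subsetI IntI CollectI)
    fix s assume s: "s \<in> N"
    have z: "\<alpha>' x = 0" if "x \<in> N" for x using harm[of x] that by (simp add: N_def)
    then show "\<alpha>' s = 0" using s .
    have "((\<lambda>x. 0) has_real_derivative \<alpha>'' s) (at s)"
      by (rule has_field_derivative_transform_within_open[OF deriv2 \<open>open N\<close> s z])
    then show "\<alpha>'' s = 0" by (rule DERIV_unique) (rule DERIV_const)
  next
    fix s assume "s \<in> {s. \<alpha>' s = 0} \<inter> {s. \<alpha>'' s = 0}"
    then have s: "\<alpha>' s = 0" "\<alpha>'' s = 0" by auto
    show "s \<in> N"
    proof (rule ccontr)
      assume "s \<notin> N"
      then have "sin (2 * \<alpha> s) = 0" using s assms(1) by (simp add: N_def pend_def)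
      then show False using constant_if_equilibrium[OF harm s(1)] nc by blast
    qed
  qed
  moreover have "closed {s. \<alpha>' s = 0}" "closed {s. \<alpha>'' s = 0}"
    using c1 cont2 by (auto intro!: closed_Collect_eq continuous_intros)
  ultimately have "closed N" by auto
  then have "N = {} \<or> N = UNIV" using \<open>open N\<close> clopen by blast
  moreover have "N \<noteq> {}" using neg by (auto simp: N_def)
  ultimately have "\<alpha>' s = 0" for s using harm[of s] by (auto simp: N_def)
  then show False using nc by blast
qed

end

section \<open>The special solutions and the torus\<close>

text \<open>The circle of latitude at polar angle \<open>a\<close>, run through with speed \<open>\<kappa>\<close>.\<close>

lemma homothetic_immersion_parallel:
  assumes j: "\<And>t. j (cis t) = rot_lift \<kappa> (\<lambda>_. a) (0, t)" and "\<kappa> \<noteq> 0" "sin a \<noteq> 0"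
  shows "homothetic_immersion unit_circle unit_sphere j"
proof -
  define F where "F t = (cos a, sin a *\<^sub>R cis (\<kappa> * t))" for t
  interpret sphere_lift cis j F
    by unfold_locales (simp_all add: F_def j rot_lift_def norm_Pair power_mult_distrib)
  have Ck: "Ck_on n F UNIV" for n
  proof -
    have t: "Ck_on n (\<lambda>t. \<kappa> * t) UNIV"
      by (rule Ck_on_linear[OF open_UNIV bounded_linear_mult_right])
    show ?thesis
      unfolding F_def
      by (rule Ck_on_Pair[OF open_UNIV Ck_on_const[OF open_UNIV]
            Ck_on_linear_comp[OF open_UNIV bounded_linear_scaleR_right
              Ck_on_compose_real[OF open_UNIV t Ck_on_cis]]])
  qed
  define F' where "F' t v = (0 :: real, sin a *\<^sub>R ((\<kappa> * v) *\<^sub>R (\<i> * cis (\<kappa> * t))))" for t v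
  have F': "(F has_derivative F' t) (at t)" for t
    unfolding F_def F'_def
    by (rule has_derivative_Pair[OF has_derivative_const has_derivative_scaleR_right[OF
          has_derivative_cis[OF has_derivative_mult_right[OF has_derivative_ident]]]])
  have inj: "v = w" if "F' t v = F' t w" for t v w
    using that assms(2,3) by (simp add: F'_def)
  have form: "F' t v \<bullet> F' t w = (\<kappa> * sin a)\<^sup>2 * (v \<bullet> w)" for t v w
  proof -
    have "(\<i> * cis (\<kappa> * t)) \<bullet> (\<i> * cis (\<kappa> * t)) = 1"
      by (simp flip: power2_norm_eq_inner add: norm_mult)
    then show ?thesis by (simp add: F'_def) (simp add: power2_eq_square)
  qed
  show ?thesis
    unfolding homothetic_immersion_def smooth_map_def unit_circle_def
  proof (intro conjI allI exI[of _ "(\<kappa> * sin a)\<^sup>2"] ballI)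
    show "Ck_map n (flat_quotient cis) unit_sphere j" for n by (rule Ck_map[OF Ck])
    show "(\<kappa> * sin a)\<^sup>2 > 0" using assms(2,3) by simp
    fix c d u assume c: "c \<in> params (flat_quotient cis)" and "d \<in> params unit_sphere"
      and u: "u \<in> loc_dom c d j"
    then obtain \<sigma> where d: "\<sigma>\<^sup>2 = 1" "d = sphere_chart \<sigma>" by (elim params_sphere)
    from c obtain U where U: "c = (U, cis)" "open U" by (auto simp: flat_quotient_def)
    note * = d(1) U(2) Ck F' u[unfolded U d]
    show "inj (dloc c d j u)"
      unfolding U d
    proof (rule injI)
      fix v w
      assume "dloc (U, cis) (sphere_chart \<sigma>) j u v = dloc (U, cis) (sphere_chart \<sigma>) j u w"
      then have "F' u v = F' u w" using derivative_loc[OF *, of v] derivative_loc[OF *, of w] by simp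
      then show "v = w" by (rule inj)
    qed
    show "pullback_form unit_sphere c d j u v w =
        (\<kappa> * sin a)\<^sup>2 * pullback_metric (flat_quotient cis) (snd c) u v w" for v w
      unfolding U d pullback_form_eq[OF *] form by (simp add: flat_quotient_def)
  qed
qed

text \<open>Here \<open>\<alpha>' = \<kappa> cos \<alpha>\<close>: the separatrix of the pendulum.\<close>

lemma (in rotational) pend_meridian:
  assumes "\<And>s. \<alpha> s = 2 * arctan (exp (\<kappa> * s + A)) - pi / 2"
  shows "pend s = 0"
proof -
  have "((\<lambda>s. 2 * arctan (exp (\<kappa> * s + A)) - pi / 2) has_real_derivative \<kappa> * cos (\<alpha> s)) (at s)" for s
  proof -
    have "cos (\<alpha> s) = sin (2 * arctan (exp (\<kappa> * s + A)))"
      by (simp add: assms cos_diff)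
    also have "\<dots> = 2 * exp (\<kappa> * s + A) / (1 + (exp (\<kappa> * s + A))\<^sup>2)"
    proof -
      have "1 + (exp (\<kappa> * s + A))\<^sup>2 > 0" by (simp add: add_pos_nonneg)
      then show ?thesis
        by (simp add: sin_double sin_arctan cos_arctan power2_eq_square[symmetric])
    qed
    finally have "cos (\<alpha> s) = 2 * exp (\<kappa> * s + A) / (1 + (exp (\<kappa> * s + A))\<^sup>2)" .
    moreover have "((\<lambda>s. 2 * arctan (exp (\<kappa> * s + A)) - pi / 2) has_real_derivative
        \<kappa> * (2 * exp (\<kappa> * s + A) / (1 + (exp (\<kappa> * s + A))\<^sup>2))) (at s)"
      by (rule derivative_eq_intros refl)+ (simp add: field_simps)
    ultimately show ?thesis by simp
  qed
  moreover have "(\<lambda>s. 2 * arctan (exp (\<kappa> * s + A)) - pi / 2) = \<alpha>" using assms by auto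
  ultimately have "(\<alpha> has_real_derivative \<kappa> * cos (\<alpha> s)) (at s)" for s by simp
  then have "\<alpha>' s = \<kappa> * cos (\<alpha> s)" for s by (rule DERIV_unique[OF deriv1])
  then have eq: "\<alpha>' = (\<lambda>s. \<kappa> * cos (\<alpha> s))" by auto
  have "((\<lambda>s. \<kappa> * cos (\<alpha> s)) has_real_derivative - (\<kappa> * (sin (\<alpha> s) * \<alpha>' s))) (at s)"
    by (rule derivative_eq_intros deriv1 refl)+ simp
  then have "\<alpha>'' s = - (\<kappa> * (sin (\<alpha> s) * \<alpha>' s))"
    by (rule DERIV_unique[OF deriv2[unfolded eq]])
  then show ?thesis by (simp add: pend_def sin_double eq power2_eq_square)
qed

lemma periodic_int_shift:
  fixes f :: "real \<Rightarrow> 'a"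
  assumes "\<And>s. f (s + T) = f s"
  shows "f (s + T * of_int n) = f s"
proof (induction n rule: int_induct[where k = 0])
  case (step1 i)
  then show ?case using assms[of "s + T * of_int i"] by (simp add: algebra_simps)
next
  case (step2 i)
  then show ?case using assms[of "s + T * of_int (i - 1)"] by (simp add: algebra_simps)
qed simp

lemma (in rotational) factors_through_torus:
  assumes harm: "\<And>s. \<alpha>' s * pend s = 0" and per: "\<And>s. \<alpha> (s + T) = \<alpha> s"
    and \<phi>: "\<And>s t. \<phi> (s, cis t) = rot_lift \<kappa> \<alpha> (s, t)"
  shows "\<exists>\<psi>. infinity_harmonic (torus T) unit_sphere \<psi> \<and>
    (\<forall>s z. (s, z) \<in> points cylinder \<longrightarrow> \<psi> (coset_of T s, z) = \<phi> (s, z))"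
proof (intro exI conjI allI impI)
  \<comment> \<open>Choice of a representative; the value does not depend on it by periodicity.\<close>
  define \<psi> where "\<psi> = (\<lambda>(X, z). \<phi> (SOME s. coset_of T s = X, z))"
  have \<psi>: "\<psi> (coset_of T s, cis t) = rot_lift \<kappa> \<alpha> (s, t)" for s t
  proof -
    define s' where "s' = (SOME s'. coset_of T s' = coset_of T s)"
    have "coset_of T s' = coset_of T s" unfolding s'_def by (rule someI) (rule refl)
    then obtain n :: int where "s' = s + T * of_int n"
      unfolding coset_of_eq_iff by (metis add.commute diff_add_cancel)
    then have "\<alpha> s' = \<alpha> s" using periodic_int_shift[of \<alpha>, OF per] by simp
    then show ?thesis by (simp add: \<psi>_def \<phi> rot_lift_def flip: s'_def)
  qed
  show "infinity_harmonic (torus T) unit_sphere \<psi>"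
    unfolding torus_def by (rule infinity_harmonic_rotI[OF _ harm]) (auto simp: \<psi>)
  show "\<psi> (coset_of T s, z) = \<phi> (s, z)" if "(s, z) \<in> points cylinder" for s z
    using that by (auto simp: cylinder_def flat_quotient_def \<psi> \<phi>)
qed

theorem theorem5p6:
  fixes k :: int and \<alpha> :: "real \<Rightarrow> real" and \<phi> :: "real \<times> complex \<Rightarrow> real \<times> complex"
  assumes "k \<noteq> 0"
    and "smooth_on \<alpha> UNIV"
    and "\<And>s t. \<phi> (s, cis t) =
      (cos (\<alpha> s), complex_of_real (sin (\<alpha> s)) * exp (\<i> * of_int k * complex_of_real t))"
  shows "(infinity_harmonic cylinder unit_sphere \<phi> \<longleftrightarrow>
      ((\<exists>a. \<forall>s. \<alpha> s = a) \<and>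
        (\<exists>j. homothetic_immersion unit_circle unit_sphere j \<and>
          (\<forall>x\<in>points cylinder. \<phi> x = j (snd x)))) \<or>
      (\<exists>A. \<forall>s. \<alpha> s = 2 * arctan (exp (real_of_int k * s + A)) - pi / 2) \<or>
      pendulum_solution (real_of_int k) (\<lambda>s. 2 * \<alpha> s)) \<and>
    (pendulum_solution (real_of_int k) (\<lambda>s. 2 * \<alpha> s) \<longrightarrow>
      (\<forall>T>0. (\<forall>s. \<alpha> (s + T) = \<alpha> s) \<longrightarrow>
        (\<exists>\<psi>. infinity_harmonic (torus T) unit_sphere \<psi> \<and>
          (\<forall>s z. (s, z) \<in> points cylinder \<longrightarrow> \<psi> (coset_of T s, z) = \<phi> (s, z)))))"
proof -
  let ?\<kappa> = "real_of_int k"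
  obtain \<alpha>' \<alpha>'' where \<alpha>: "\<And>s. (\<alpha> has_real_derivative \<alpha>' s) (at s)"
    "\<And>s. (\<alpha>' has_real_derivative \<alpha>'' s) (at s)" "continuous_on UNIV \<alpha>''"
    using smooth_real_derivatives[OF assms(2)] by blast
  interpret rotational ?\<kappa> \<alpha> \<alpha>' \<alpha>''
    by unfold_locales (fact assms(2) \<alpha>)+
  have \<kappa>: "?\<kappa> \<noteq> 0" using assms(1) by simp
  have \<phi>: "\<phi> (s, cis t) = rot_lift ?\<kappa> \<alpha> (s, t)" for s t
    unfolding assms(3) rot_lift_def by (simp add: cis_conv_exp scaleR_conv_of_real mult_ac)
  let ?p = "\<lambda>(s, t). (s, cis t)"
  have lift: "\<phi> (?p u) = rot_lift ?\<kappa> \<alpha> u" for u by (cases u) (simp add: \<phi>)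
  have harmonic_iff: "infinity_harmonic cylinder unit_sphere \<phi> \<longleftrightarrow> (\<forall>s. \<alpha>' s * pend s = 0)"
  proof
    assume harm: "infinity_harmonic cylinder unit_sphere \<phi>"
    \<comment> \<open>One chart suffices, since the condition depends on \<open>s\<close> only.\<close>
    have inj: "inj_on ?p (UNIV \<times> {-1<..<1})"
    proof (rule inj_onI, clarsimp)
      fix t t' :: real
      assume "cis t = cis t'" and t: "- 1 < t" "t < 1" "- 1 < t'" "t' < 1"
      then obtain n :: int where n: "t - t' = 2 * pi * of_int n" by (auto simp: cis_eq_iff)
      moreover have "\<bar>t - t'\<bar> < 2 * pi" using t pi_gt3 by linarith
      ultimately have "n = 0" using multiple_small[of "2 * pi" n] by simp
      then show "t = t'" using n by simp
    qed
    show "\<forall>s. \<alpha>' s * pend s = 0"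
    proof
      fix s
      show "\<alpha>' s * pend s = 0"
        by (rule infinity_harmonic_rotD[of \<phi> ?p, OF lift harm[unfolded cylinder_def] _ inj, of s 0])
          (auto intro: open_Times)
    qed
  next
    assume "\<forall>s. \<alpha>' s * pend s = 0"
    then show "infinity_harmonic cylinder unit_sphere \<phi>"
      unfolding cylinder_def by (intro infinity_harmonic_rotI[of \<phi> ?p, OF lift]) auto
  qed
  show ?thesis
  proof (intro conjI iffI)
    assume "infinity_harmonic cylinder unit_sphere \<phi>"
    then have harm: "\<And>s. \<alpha>' s * pend s = 0" using harmonic_iff by blast
    show "((\<exists>a. \<forall>s. \<alpha> s = a) \<and>
        (\<exists>j. homothetic_immersion unit_circle unit_sphere j \<and>
          (\<forall>x\<in>points cylinder. \<phi> x = j (snd x)))) \<or>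
      (\<exists>A. \<forall>s. \<alpha> s = 2 * arctan (exp (?\<kappa> * s + A)) - pi / 2) \<or>
      pendulum_solution ?\<kappa> (\<lambda>s. 2 * \<alpha> s)" (is "?const \<or> _ \<or> ?pend")
    proof (cases ?pend)
      case False
      then obtain a where a: "\<And>s. \<alpha> s = a"
        using constant_or_pendulum[OF \<kappa> harm] pendulum_solution_iff by blast
      have \<alpha>_const: "\<alpha> = (\<lambda>_. a)" using a by auto
      have sin_nonzero: "sin a \<noteq> 0"
      proof
        assume "sin a = 0"
        then have "sin (2 * \<alpha> s) = 0" for s by (simp add: a sin_double)
        then have ?pend unfolding pendulum_solution_def a
          by (intro exI[of _ "\<lambda>_. 0"] allI conjI DERIV_const) simp
        with False show False ..
      qed
      have "homothetic_immersion unit_circle unit_sphere (\<lambda>z. \<phi> (0, z))"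
        by (rule homothetic_immersion_parallel[OF _ \<kappa> sin_nonzero]) (unfold \<phi> \<alpha>_const, rule refl)
      moreover have "\<forall>x\<in>points cylinder. \<phi> x = \<phi> (0, snd x)"
        by (auto simp: cylinder_def flat_quotient_def \<phi> rot_lift_def a)
      ultimately have ?const
        using a by (intro conjI exI[of _ a] exI[of _ "\<lambda>z. \<phi> (0, z)"]) auto
      then show ?thesis by (rule disjI1)
    qed simp
  next
    assume "((\<exists>a. \<forall>s. \<alpha> s = a) \<and>
        (\<exists>j. homothetic_immersion unit_circle unit_sphere j \<and>
          (\<forall>x\<in>points cylinder. \<phi> x = j (snd x)))) \<or>
      (\<exists>A. \<forall>s. \<alpha> s = 2 * arctan (exp (?\<kappa> * s + A)) - pi / 2) \<or>
      pendulum_solution ?\<kappa> (\<lambda>s. 2 * \<alpha> s)"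
    then consider a where "\<And>s. \<alpha> s = a"
      | A where "\<And>s. \<alpha> s = 2 * arctan (exp (?\<kappa> * s + A)) - pi / 2"
      | "pendulum_solution ?\<kappa> (\<lambda>s. 2 * \<alpha> s)"
      by blast
    then have "\<forall>s. \<alpha>' s * pend s = 0"
    proof cases
      case 1
      have "\<alpha>' s = 0" for s
      proof -
        have "\<alpha> = (\<lambda>_. a)" using 1 by auto
        then have "(\<alpha> has_real_derivative 0) (at s)" by simp
        then show ?thesis by (rule DERIV_unique[OF deriv1])
      qed
      then show ?thesis by simp
    next
      case 2
      then show ?thesis using pend_meridian by simp
    next
      case 3
      then show ?thesis using pendulum_solution_iff by simp
    qed
    then show "infinity_harmonic cylinder unit_sphere \<phi>" using harmonic_iff by blast
  next
    show "pendulum_solution ?\<kappa> (\<lambda>s. 2 * \<alpha> s) \<longrightarrow>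
      (\<forall>T>0. (\<forall>s. \<alpha> (s + T) = \<alpha> s) \<longrightarrow>
        (\<exists>\<psi>. infinity_harmonic (torus T) unit_sphere \<psi> \<and>
          (\<forall>s z. (s, z) \<in> points cylinder \<longrightarrow> \<psi> (coset_of T s, z) = \<phi> (s, z))))"
    proof (intro impI allI)
      fix T :: real
      assume "pendulum_solution ?\<kappa> (\<lambda>s. 2 * \<alpha> s)" and per: "\<forall>s. \<alpha> (s + T) = \<alpha> s"
      then have "\<alpha>' s * pend s = 0" for s using pendulum_solution_iff by simp
      then show "\<exists>\<psi>. infinity_harmonic (torus T) unit_sphere \<psi> \<and>
          (\<forall>s z. (s, z) \<in> points cylinder \<longrightarrow> \<psi> (coset_of T s, z) = \<phi> (s, z))"
        by (rule factors_through_torus) (simp_all add: per \<phi>)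
    qed
  qed
qed

end
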